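(* Let $n\ge1$ and let $p$ be a nonnegative integer. If $\pi\in S_n$ is a permutation with exactly $k$ descents, then the number of permutations $\sigma\in S_n$ that have exactly $p$ valleys and that satisfy $s(\sigma)=\pi$ is given by \[2^{n-2p+1}\sum_{\substack{\mathscr H\in\mathcal H_{\{0,2\}}(\pi)\\ j_0+j_1+\cdots+j_k=p}}\ \prod_{t=0}^k\binom{\widehat q_t(\mathscr H)-1}{2j_t-2}C_{j_t-1},\] where the numbers $j_0,j_1,\ldots,j_k$ in the sum are positive integers, $s$ is the deterministic stack-sorting map, and $C_i$ is the $i$-th Catalan number.
   Context: Notation: $[m]=\{1,\ldots,m\}$; permutations in $S_n$ are written as words $\pi_1\cdots\pi_n$. A descent of $\pi$ is an index $i\in[n-1]$ with $\pi_i>\pi_{i+1}$. A valley of a permutation $\sigma_1\cdots\sigma_n$ is an index $i\in\{1,\ldots,n\}$ such that $\sigma_i<\min\{\sigma_{i-1},\sigma_{i+1}\}$, with the convention $\sigma_0=\sigma_{n+1}=\infty$. Stack-sorting map. Given an input permutation $\sigma=\sigma_1\cdots\sigma_n$, $s(\sigma)$ is computed using a vertical stack (initially empty): at any time, if the leftmost remaining entry of the input is smaller than the entry at the top of the stack, or if the stack is empty, that leftmost entry is placed on top of the stack; otherwise the entry at the top of the stack is removed and annexed to the right end of the growing output. (Once the input is exhausted, the stack is emptied into the output from the top.) The final output is $s(\sigma)$. For example, $s(35214)=31245$. Valid hook configurations. The diagram of $\pi$ consists of the points $(i,\pi_i)$, $i\in[n]$. A hook $H$ is determined by indices $i<j$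 with $\pi_i<\pi_j$: it is the union of the vertical segment from $(i,\pi_i)$ to $(i,\pi_j)$ and the horizontal segment from $(i,\pi_j)$ to $(j,\pi_j)$. Its southwest endpoint is ${}_eH=(i,\pi_i)$ and its northeast endpoint is $H^e=(j,\pi_j)$. A valid hook configuration of $\pi$ is an $m$-tuple $\mathscr H=(H_1,\ldots,H_m)$ ($m\ge 0$) of hooks in the diagram of $\pi$ such that: (a) if ${}_eH_\ell=(i_\ell,\pi_{i_\ell})$ for each $\ell\in[m]$, then $i_1<i_2<\cdots<i_m$; (b) if $i$ is a descent of $\pi$, then $(i,\pi_i)={}_eH_\ell$ for some $\ell\in[m]$; (c) if $(j,\pi_j)=H_\ell^e$ for some $\ell\in[m]$, then there exist $\ell',\ell''\in[m]$ such that the $x$-coordinate of ${}_eH_{\ell'}$ is a descent of $\pi$, $(j-1,\pi_{j-1})={}_eH_{\ell''}$, and $H_{\ell'}^e=H_{\ell''}^e=(j,\pi_j)$; (d) if $\ell,\ell'\in[m]$, ${}_eH_\ell=(i,\pi_i)$, $H_\ell^e=(j,\pi_j)$, ${}_eH_{\ell'}=(i',\pi_{i'})$, $H_{\ell'}^e=(j',\pi_{j'})$, $\pi_j<\pi_{j'}$, and the real intervals $[i,j]$ and $[i',j']$ have more than one point in common, then $[i,j]\subseteq[i',j']$. The identity permutation has exactly one valid hook configuration, the empty one. Write $\mathcal H(\pi)$ for the set of valid hook configurations of $\pi$, $|\mathscr H|=m$ for the number of hooks, and $NE(\mathscr H)=\{H_1^e,\ldots,H_m^e\}$. For $j\in[n]$,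 $w_j(\mathscr H)$ is the number of hooks in $\mathscr H$ with northeast endpoint $(j,\pi_j)$. $\mathcal H_{\{0,2\}}(\pi)=\{\mathscr H\in\mathcal H(\pi): w_j(\mathscr H)\in\{0,2\}\text{ for all }j\in[n]\}$. Coloring. Given $\mathscr H=(H_1,\ldots,H_m)\in\mathcal H(\pi)$, color the points of the diagram with colors $c_0,\ldots,c_m$. The hook $H_\ell$ has color $c_\ell$; if ${}_eH_\ell=(i,\pi_i)$ and $H_\ell^e=(j,\pi_j)$, its top part is the segment from $(i+1/2,\pi_j)$ to $(j,\pi_j)$. If $(k,\pi_k)\in NE(\mathscr H)$, give $(k,\pi_k)$ the color $c_r$ where $r$ is the largest index with $H_r^e=(k,\pi_k)$. Otherwise move directly upward from $(k,\pi_k)$ until first hitting the top part of a hook, and give $(k,\pi_k)$ the color of that hook; if several hooks are hit simultaneously, use the one whose southwest endpoint is farthest to the right; if no top part is hit, use $c_0$. Let $q_t(\mathscr H)$ be the number of points $(\ell,\pi_\ell)$ of color $c_t$. Reduced color counts. Let $\Theta(\mathscr H)$ be the set of $i\in\{0,1,\ldots,|\mathscr H|\}$ such that $c_i$ is not the color of any point in $NE(\mathscr H)$, and $\widehat{|\mathscr H|}=|\Theta(\mathscr H)|-1=|\mathscr H|-|NE(\mathscr H)|$. Writing $\Theta(\mathscr H)=\{i_0<i_1<\cdots<i_{\widehat{|\mathscr H|}}\}$, set $\widehat q_t(\mathscr H)=q_{i_t}(\mathscr H)$. For $\mathscr H\in\mathcal H_{\{0,2\}}(\pi)$ with $\pi$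 having $k$ descents, $\widehat{|\mathscr H|}=k$. *)

theory Defs
  imports Complex_Main "HOL-Library.Extended_Nat" "HOL-Combinatorics.Multiset_Permutations"
begin

text \<open>
  The permutations of \<open>[n]\<close> are the words in \<^term>\<open>permutations_of_set {1..n}\<close>. All positions
  are counted from 1, hence the following indexing operator.
\<close>

definition nth1 :: "'a list \<Rightarrow> nat \<Rightarrow> 'a"  (infixl \<open>!\<^sub>1\<close> 100)
  where "xs !\<^sub>1 i = xs ! (i - 1)"

definition descents :: "nat list \<Rightarrow> nat set"
  where "descents \<pi> = {i. 1 \<le> i \<and> i < length \<pi> \<and> \<pi> !\<^sub>1 i > \<pi> !\<^sub>1 (i + 1)}"

definition padded :: "nat list \<Rightarrow> nat \<Rightarrow> enat"
  where "padded \<sigma> i = (if i \<in> {1..length \<sigma>} then enat (\<sigma> !\<^sub>1 i) else \<infinity>)"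

definition valleys :: "nat list \<Rightarrow> nat set"
  where "valleys \<sigma> = {i \<in> {1..length \<sigma>}. padded \<sigma> i < min (padded \<sigma> (i - 1)) (padded \<sigma> (i + 1))}"

text \<open>
  \<open>stack_run input stack\<close> is the output still to be produced from the given state of the
  machine; the head of \<open>stack\<close> is its top.
\<close>

fun stack_run :: "nat list \<Rightarrow> nat list \<Rightarrow> nat list" where
  "stack_run [] st = st"
| "stack_run (x # xs) [] = stack_run xs [x]"
| "stack_run (x # xs) (y # st) =
     (if x < y then stack_run xs (x # y # st) else y # stack_run (x # xs) st)"

definition stack_sort :: "nat list \<Rightarrow> nat list"
  where "stack_sort \<sigma> = stack_run \<sigma> []"

lemma "stack_sort [3, 5, 2, 1, 4] = [3, 1, 2, 4, 5]"
  by (simp add: stack_sort_def)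

text \<open>
  A hook in the diagram of \<open>\<pi>\<close> is represented by the pair of the \<open>x\<close>-coordinates of its southwest
  and northeast endpoints. As a diagram has exactly one point \<open>(i, \<pi> !\<^sub>1 i)\<close> over each \<open>i\<close>, points
  of the diagram are likewise represented by their \<open>x\<close>-coordinates.
\<close>

type_synonym hook = "nat \<times> nat"

abbreviation sw :: "hook \<Rightarrow> nat" where "sw \<equiv> fst"

abbreviation ne :: "hook \<Rightarrow> nat" where "ne \<equiv> snd"

definition is_hook :: "nat list \<Rightarrow> hook \<Rightarrow> bool"
  where "is_hook \<pi> h \<longleftrightarrow> 1 \<le> sw h \<and> sw h < ne h \<and> ne h \<le> length \<pi> \<and> \<pi> !\<^sub>1 sw h < \<pi> !\<^sub>1 ne h"

definition hook_interval :: "hook \<Rightarrow> real set"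
  where "hook_interval h = {real (sw h)..real (ne h)}"

definition valid_hook_configurations :: "nat list \<Rightarrow> hook list set"
  where "valid_hook_configurations \<pi> = {H.
    (\<forall>h\<in>set H. is_hook \<pi> h) \<and>
    sorted_wrt (<) (map sw H) \<and>
    (\<forall>i\<in>descents \<pi>. \<exists>h\<in>set H. sw h = i) \<and>
    (\<forall>h\<in>set H. \<exists>h'\<in>set H. \<exists>h''\<in>set H.
       sw h' \<in> descents \<pi> \<and> sw h'' = ne h - 1 \<and> ne h' = ne h \<and> ne h'' = ne h) \<and>
    (\<forall>h\<in>set H. \<forall>h'\<in>set H.
       \<pi> !\<^sub>1 ne h < \<pi> !\<^sub>1 ne h' \<and>
       (\<exists>x y. x \<noteq> y \<and> {x, y} \<subseteq> hook_interval h \<inter> hook_interval h') \<longrightarrow>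
       hook_interval h \<subseteq> hook_interval h')}"

definition NE :: "hook list \<Rightarrow> nat set"
  where "NE H = ne ` set H"

definition ne_count :: "hook list \<Rightarrow> nat \<Rightarrow> nat"
  where "ne_count H j = card {l \<in> {1..length H}. ne (H !\<^sub>1 l) = j}"

definition valid_hook_configurations_02 :: "nat list \<Rightarrow> hook list set"
  where "valid_hook_configurations_02 \<pi> =
    {H \<in> valid_hook_configurations \<pi>. \<forall>j\<in>{1..length \<pi>}. ne_count H j \<in> {0, 2}}"

text \<open>
  \<open>hit \<pi> H k\<close> consists of the indices of the hooks whose top part meets the vertical ray going
  up from the point over \<open>k\<close>, and \<open>first_hit \<pi> H k\<close> of those that are met first.
\<close>

definition hit :: "nat list \<Rightarrow> hook list \<Rightarrow> nat \<Rightarrow> nat set"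
  where "hit \<pi> H k = {l \<in> {1..length H}.
    real k \<in> {real (sw (H !\<^sub>1 l)) + 1/2..real (ne (H !\<^sub>1 l))} \<and> \<pi> !\<^sub>1 k \<le> \<pi> !\<^sub>1 ne (H !\<^sub>1 l)}"

definition first_hit :: "nat list \<Rightarrow> hook list \<Rightarrow> nat \<Rightarrow> nat set"
  where "first_hit \<pi> H k = {l \<in> hit \<pi> H k.
    \<forall>l'\<in>hit \<pi> H k. \<pi> !\<^sub>1 ne (H !\<^sub>1 l) \<le> \<pi> !\<^sub>1 ne (H !\<^sub>1 l')}"

text \<open>The number \<open>t\<close> stands for the color \<open>c\<^sub>t\<close>.\<close>

definition color :: "nat list \<Rightarrow> hook list \<Rightarrow> nat \<Rightarrow> nat"
  where "color \<pi> H k =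
    (if k \<in> NE H then Max {r \<in> {1..length H}. ne (H !\<^sub>1 r) = k}
     else if hit \<pi> H k = {} then 0
     else (ARG_MAX (\<lambda>l. sw (H !\<^sub>1 l)) l. l \<in> first_hit \<pi> H k))"

definition q :: "nat list \<Rightarrow> hook list \<Rightarrow> nat \<Rightarrow> nat"
  where "q \<pi> H t = card {l \<in> {1..length \<pi>}. color \<pi> H l = t}"

definition Theta :: "nat list \<Rightarrow> hook list \<Rightarrow> nat set"
  where "Theta \<pi> H = {i \<in> {0..length H}. \<forall>k\<in>NE H. color \<pi> H k \<noteq> i}"

definition q_hat :: "nat list \<Rightarrow> hook list \<Rightarrow> nat \<Rightarrow> nat"
  where "q_hat \<pi> H t = q \<pi> H (sorted_list_of_set (Theta \<pi> H) ! t)"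

definition catalan :: "nat \<Rightarrow> nat"
  where "catalan i = ((2 * i) choose i) div (i + 1)"

text \<open>Sequences \<open>(j\<^sub>0, \<dots>, j\<^sub>k)\<close> of positive integers with sum \<open>p\<close>.\<close>

definition compositions :: "nat \<Rightarrow> nat \<Rightarrow> nat list set"
  where "compositions k p = {js. length js = k + 1 \<and> (\<forall>j\<in>set js. 0 < j) \<and> sum_list js = p}"

end

theory Submission
  imports Defs "HOL-Computational_Algebra.Formal_Power_Series"
begin

text \<open>
  Cutting a permutation at its maximum, \<open>\<sigma> = L m R\<close>, gives \<open>s(\<sigma>) = s(L) s(R) m\<close>, while
  valleys add up. So the \<open>\<sigma>\<close> with \<open>s(\<sigma>) = \<pi>\<close> correspond to the decreasing binary plane trees with
  postorder \<open>\<pi>\<close>, valleys being leaves. A tree with \<open>p\<close> leaves has \<open>n - 2p + 1\<close> nodes with a single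
  child; dividing out their orientations leaves unary-binary trees.

  Let \<open>d\<close> be the descent of \<open>\<pi>\<close> with the largest value. In such a tree \<open>d\<close> is the left child of
  some \<open>j\<close> with \<open>\<pi>\<^sub>j > \<pi>\<^sub>d\<close>, whose right subtree occupies the positions \<open>d + 1, \<dots>, j - 1\<close>.
  Detaching that subtree and contracting \<open>j\<close> to \<open>d\<close> leaves two independent trees, and by the choice
  of \<open>d\<close> every pair of trees on these two words arises for every \<open>j\<close>. Hook configurations
  satisfy the same recursion: cut at the hook from \<open>d\<close> to \<open>j\<close>. The points directly below
  that hook are those of color \<open>c\<^sub>0\<close> in the part from \<open>d + 1\<close> to \<open>j - 1\<close>. Without descents, both
  sides count all unary-binary plane trees with the given number of nodes.
\<close>

section \<open>Stack-sorting and valleys\<close>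

text \<open>A descent is never a right or an only child, since its parent would follow it at once in
  postorder. The choice of the largest value matters as follows: an inversion with top above
  \<open>\<pi> d\<close> would force a descent higher than \<open>d\<close>. Hence, for
  \<open>j\<close> right of \<open>d\<close> with \<open>\<pi> j > \<pi> d\<close>, all values right
  of \<open>j\<close> exceed \<open>\<pi> j\<close>, and all values between \<open>d\<close> and
  \<open>j\<close> stay below it. So any tree on the values in between may be hung below
  \<open>j\<close>, and the parent of \<open>d\<close> in a contracted tree is also large enough to
  be a parent of \<open>j\<close>.

  Detaching a subtree leaves positions with a gap. The statements are therefore about a fixed map
  \<open>\<pi>\<close> and an arbitrary finite set \<open>A\<close> of positions. Both sides become
  power series that mark the leaves, and these are compared through their common recursion; no
  bijection between trees and hook configurations is built.

  The binomial coefficients arise from chains: a full binary tree with \<open>p\<close> leaves has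
  \<open>2p - 1\<close> nodes, and the \<open>n\<close> nodes of a unary-binary tree are distributed
  over that many nonempty chains, in \<open>(n - 1) choose (2p - 2)\<close> ways.\<close>

lemma mset_stack_run: "mset (stack_run xs st) = mset xs + mset st"
  by (induction xs st rule: stack_run.induct) auto

lemma mset_stack_sort: "mset (stack_sort \<sigma>) = mset \<sigma>"
  by (simp add: stack_sort_def mset_stack_run)

lemma set_stack_sort: "set (stack_sort \<sigma>) = set \<sigma>"
  by (metis mset_stack_sort set_mset_mset)

lemma length_stack_sort: "length (stack_sort \<sigma>) = length \<sigma>"
  by (metis mset_stack_sort size_mset)

lemma stack_run_larger:
  "\<forall>x\<in>set st. x < m \<Longrightarrow> stack_run (m # R) st = st @ stack_run R [m]"
  by (induction st) auto

text \<open>The arrival of \<open>m\<close> empties the stack into the output, so nothing read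
  before \<open>m\<close> interacts with \<open>R\<close>; what remains is a run of \<open>R\<close>
  above \<open>m\<close>.\<close>

lemma stack_run_append_larger:
  "\<forall>x\<in>set L \<union> set st. x < m \<Longrightarrow> stack_run (L @ m # R) st = stack_run L st @ stack_run R [m]"
  by (induction L st rule: stack_run.induct) (auto simp: stack_run_larger)

text \<open>An entry larger than all of the input behaves like the floor of the stack: every
  \<open>x\<close> may be placed on it, and it leaves only when the input is exhausted.\<close>

lemma stack_run_bottom:
  "\<forall>x\<in>set R. x < m \<Longrightarrow> stack_run R (st @ [m]) = stack_run R st @ [m]"
  by (induction R st rule: stack_run.induct) auto

lemma stack_sort_max:
  assumes "\<forall>x\<in>set L \<union> set R. x < m"
  shows "stack_sort (L @ m # R) = stack_sort L @ stack_sort R @ [m]"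
  using stack_run_append_larger[of L "[]" m R] stack_run_bottom[of R m "[]"] assms
  by (simp add: stack_sort_def)

lemma nth1_append_left: "1 \<le> i \<Longrightarrow> i \<le> length xs \<Longrightarrow> (xs @ ys) !\<^sub>1 i = xs !\<^sub>1 i"
  by (auto simp: nth1_def nth_append)

lemma nth1_in_set: "1 \<le> i \<Longrightarrow> i \<le> length xs \<Longrightarrow> xs !\<^sub>1 i \<in> set xs"
  by (simp add: nth1_def)

text \<open>To its neighbours the maximum \<open>m\<close> looks like the padding value \<infinity>,
  so each of them is a valley of the whole word iff it is one of its own factor. A nonempty factor
  supplies \<open>m\<close> with a smaller neighbour, which keeps \<open>m\<close> itself from being
  a valley.\<close>

lemma card_valleys_max:
  assumes less: "\<forall>x\<in>set L \<union> set R. x < m" and "L \<noteq> [] \<or> R \<noteq> []"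
  shows "card (valleys (L @ m # R)) = card (valleys L) + card (valleys R)"
proof -
  let ?w = "L @ m # R" and ?l = "length L"
  have left: "padded ?w i = padded L i" if "i \<le> ?l" for i
    using that by (auto simp: padded_def nth1_append_left)
  have mid: "padded ?w (Suc ?l) = enat m"
    by (simp add: padded_def nth1_def)
  have right: "padded ?w (Suc ?l + i) = padded R i" if "1 \<le> i" for i
    using that by (auto simp: padded_def nth1_def nth_append nth_Cons split: nat.splits)
  have lessL: "padded L i < enat m" if "i \<in> {1..?l}" for i
    using that less by (auto simp: padded_def nth1_in_set)
  have lessR: "padded R i < enat m" if "i \<in> {1..length R}" for i
    using that less by (auto simp: padded_def nth1_in_set)
  have endL: "padded L (Suc ?l) = \<infinity>" and startR: "padded R 0 = \<infinity>"
    by (auto simp: padded_def)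
  have enatL: "\<exists>k. padded L i = enat k" if "i \<in> {1..?l}" for i
    using that by (auto simp: padded_def)
  have enatR: "\<exists>k. padded R i = enat k" if "i \<in> {1..length R}" for i
    using that by (auto simp: padded_def)
  have L: "i \<in> valleys ?w \<longleftrightarrow> i \<in> valleys L" if "i \<in> {1..?l}" for i
  proof (cases "i = ?l")
    case True
    then show ?thesis using that left[of i] left[of "i - 1"] mid lessL[of i] enatL[of i] endL
      by (auto simp: valleys_def)
  next
    case False
    then show ?thesis using that left[of i] left[of "i - 1"] left[of "i + 1"]
      by (auto simp: valleys_def)
  qed
  have R: "Suc ?l + i \<in> valleys ?w \<longleftrightarrow> i \<in> valleys R" if "i \<in> {1..length R}" for i
  proof (cases "i = 1")
    case True
    then show ?thesis using that right[of 1] right[of 2] mid lessR[of 1] enatR[of 1] startR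
      by (auto simp: valleys_def numeral_2_eq_2)
  next
    case False
    then have "1 \<le> i - 1" "Suc ?l + i - 1 = Suc ?l + (i - 1)" using that by auto
    then show ?thesis using that right[of i] right[of "i - 1"] right[of "i + 1"]
      by (auto simp: valleys_def)
  qed
  have M: "Suc ?l \<notin> valleys ?w"
  proof (cases "L = []")
    case True
    then show ?thesis using assms(2) right[of 1] lessR[of 1] mid
      by (auto simp: valleys_def Suc_le_eq)
  next
    case False
    then show ?thesis using left[of ?l] lessL[of ?l] mid
      by (auto simp: valleys_def Suc_le_eq)
  qed
  have "valleys ?w = valleys L \<union> (\<lambda>i. Suc ?l + i) ` valleys R"
  proof (intro set_eqI iffI)
    fix i assume i: "i \<in> valleys ?w"
    then have "i \<in> {1..?l + 1 + length R}" by (auto simp: valleys_def)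
    moreover have "i \<noteq> Suc ?l" using i M by auto
    ultimately consider "i \<in> {1..?l}" | r where "i = Suc ?l + r" "r \<in> {1..length R}"
      by (metis Suc_eq_plus1 add_le_cancel_left atLeastAtMost_iff le_add1 le_add_diff_inverse
          le_antisym nat_le_linear not_less_eq_eq plus_1_eq_Suc add_Suc_right)
    then show "i \<in> valleys L \<union> (\<lambda>i. Suc ?l + i) ` valleys R"
      using i L R by cases auto
  next
    fix i assume "i \<in> valleys L \<union> (\<lambda>i. Suc ?l + i) ` valleys R"
    then show "i \<in> valleys ?w"
    proof
      assume "i \<in> valleys L"
      then show ?thesis using L[of i] by (auto simp: valleys_def)
    next
      assume "i \<in> (\<lambda>i. Suc ?l + i) ` valleys R"
      then obtain r where "i = Suc ?l + r" "r \<in> valleys R" by auto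
      then show ?thesis using R[of r] by (auto simp: valleys_def)
    qed
  qed
  moreover have "valleys L \<inter> (\<lambda>i. Suc ?l + i) ` valleys R = {}"
    by (auto simp: valleys_def)
  moreover have "finite (valleys L)" "finite (valleys R)"
    by (auto simp: valleys_def)
  ultimately show ?thesis
    by (simp add: card_Un_disjoint card_image inj_on_def)
qed

lemma card_valleys_Nil: "card (valleys []) = 0"
  by (simp add: valleys_def)

lemma card_valleys_single: "card (valleys [m]) = 1"
proof -
  have "valleys [m] = {1}" by (auto simp: valleys_def padded_def)
  then show ?thesis by simp
qed

text \<open>A converse of \<open>stack_sort_max\<close>: cutting \<sigma> at its largest entry shows
  that this entry comes out last, hence is \<open>m\<close>.\<close>

lemma stack_sort_snocD:
  assumes s: "stack_sort \<sigma> = u @ [m]" and dist: "distinct (u @ [m])"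
  shows "\<forall>x\<in>set u. x < m"
    and "\<exists>L R. \<sigma> = L @ m # R \<and> stack_sort L @ stack_sort R = u"
proof -
  define M where "M = Max (set \<sigma>)"
  have set: "set \<sigma> = insert m (set u)" using set_stack_sort[of \<sigma>] s by simp
  then have "M \<in> set \<sigma>" unfolding M_def by (intro Max_in) auto
  then obtain L R where LR: "\<sigma> = L @ M # R" by (meson split_list)
  have "distinct \<sigma>"
    using dist s mset_stack_sort[of \<sigma>] by (metis mset_eq_imp_distinct_iff)
  then have less: "\<forall>x\<in>set L \<union> set R. x < M"
  proof (intro ballI)
    fix x assume "x \<in> set L \<union> set R"
    then have "x \<in> set \<sigma>" "x \<noteq> M" using \<open>distinct \<sigma>\<close> LR by auto
    then show "x < M" using Max_ge[of "set \<sigma>" x] by (simp add: M_def le_neq_implies_less)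
  qed
  then have *: "stack_sort L @ stack_sort R @ [M] = u @ [m]"
    using s stack_sort_max[OF less] LR by simp
  then have "M = m" and u: "stack_sort L @ stack_sort R = u" by (simp_all flip: append_assoc)
  then show "\<exists>L R. \<sigma> = L @ m # R \<and> stack_sort L @ stack_sort R = u" using LR by blast
  have "set u = set L \<union> set R" using u by (auto simp: set_stack_sort)
  then show "\<forall>x\<in>set u. x < m" using less \<open>M = m\<close> by simp
qed

section \<open>Words read off a set of positions\<close>

definition word :: "(nat \<Rightarrow> nat) \<Rightarrow> nat set \<Rightarrow> nat list"
  where "word \<pi> A = map \<pi> (sorted_list_of_set A)"

lemma set_word: "finite A \<Longrightarrow> set (word \<pi> A) = \<pi> ` A"
  by (simp add: word_def)

lemma length_word: "length (word \<pi> A) = card A"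
  by (simp add: word_def)

lemma distinct_word: "inj_on \<pi> A \<Longrightarrow> distinct (word \<pi> A)"
  by (cases "finite A") (simp_all add: word_def distinct_map)

lemma sorted_list_of_set_split:
  assumes "finite (A :: nat set)"
  shows "sorted_list_of_set A = sorted_list_of_set (A \<inter> {..i}) @ sorted_list_of_set (A \<inter> {i<..})"
proof -
  have "sorted_list_of_set (A \<inter> {..i}) @ sorted_list_of_set (A \<inter> {i<..})
      = sorted_list_of_set (set (sorted_list_of_set (A \<inter> {..i}) @ sorted_list_of_set (A \<inter> {i<..})))"
    using assms by (intro sorted_list_of_set.idem_if_sorted_distinct[symmetric])
      (auto simp: sorted_append)
  also have "set (sorted_list_of_set (A \<inter> {..i}) @ sorted_list_of_set (A \<inter> {i<..})) = A"
    using assms by auto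
  finally show ?thesis by simp
qed

lemma word_split: "finite A \<Longrightarrow> word \<pi> A = word \<pi> (A \<inter> {..i}) @ word \<pi> (A \<inter> {i<..})"
  unfolding word_def by (subst sorted_list_of_set_split[of A i]) auto

lemma word_insert_max:
  assumes "finite A" "\<forall>i\<in>A. i < m"
  shows "word \<pi> (insert m A) = word \<pi> A @ [\<pi> m]"
proof -
  have "sorted_list_of_set A @ [m] = sorted_list_of_set (set (sorted_list_of_set A @ [m]))"
    using assms by (intro sorted_list_of_set.idem_if_sorted_distinct[symmetric])
      (auto simp: sorted_append)
  also have "set (sorted_list_of_set A @ [m]) = insert m A"
    using assms by auto
  finally show ?thesis unfolding word_def by (metis list.map(1,2) map_append)
qed

text \<open>A cut is recorded by the position \<open>i\<close> of the last letter of the left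
  factor, with \<open>0\<close> for an empty left factor. As \<open>0\<close> is not in
  \<open>A\<close>, the set \<open>insert 0 A\<close> has exactly one name for each cut.\<close>

lemma append_eq_wordD:
  assumes fin: "finite A" and eq: "a @ b = word \<pi> A" and "0 \<notin> A"
  shows "\<exists>i\<in>insert 0 A. a = word \<pi> (A \<inter> {..i}) \<and> b = word \<pi> (A \<inter> {i<..})"
proof -
  let ?xs = "sorted_list_of_set A"
  define k where "k = length a"
  define i where "i = (if k = 0 then 0 else ?xs ! (k - 1))"
  have len: "length a + length b = card A" using arg_cong[OF eq, of length] by (simp add: length_word)
  have "i \<in> set ?xs" if "k \<noteq> 0"
    using len that unfolding i_def k_def by (auto intro!: nth_mem simp flip: length_greater_0_conv)
  then have iA: "i \<in> insert 0 A"
    using fin by (auto simp: i_def)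
  have "card (A \<inter> {..i}) = k"
  proof (cases "k = 0")
    case True
    then show ?thesis using \<open>0 \<notin> A\<close> by (auto simp: i_def)
  next
    case False
    then have "k - 1 < card A" using len by (auto simp: k_def simp flip: length_greater_0_conv)
    then have "?xs ! r \<le> i \<longleftrightarrow> r < k" if "r < card A" for r
      using False that len strict_sorted_list_of_set[of A]
        sorted_wrt_nth_less[of "(<)" ?xs r "k - 1"] sorted_wrt_nth_less[of "(<)" ?xs "k - 1" r]
      by (cases r "k - 1" rule: linorder_cases) (auto simp: i_def k_def)
    note le_iff = this
    have "A \<inter> {..i} = (\<lambda>r. ?xs ! r) ` {..<k}"
    proof (intro set_eqI iffI)
      fix x assume x: "x \<in> A \<inter> {..i}"
      then have "x \<in> set ?xs" using fin by simp
      then obtain r where "r < length ?xs" "x = ?xs ! r" unfolding in_set_conv_nth by blast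
      then show "x \<in> (\<lambda>r. ?xs ! r) ` {..<k}" using x le_iff[of r] by simp
    next
      fix x assume "x \<in> (\<lambda>r. ?xs ! r) ` {..<k}"
      then obtain r where r: "r < k" "r < card A" "x = ?xs ! r" using len by (auto simp: k_def)
      then have "x \<in> set ?xs" by simp
      then show "x \<in> A \<inter> {..i}" using r le_iff[of r] fin by simp
    qed
    moreover have "inj_on (\<lambda>r. ?xs ! r) {..<k}"
      using len by (intro inj_on_nth) (auto simp: k_def)
    ultimately show ?thesis by (simp add: card_image)
  qed
  then have "length a = length (word \<pi> (A \<inter> {..i}))" by (simp add: length_word k_def)
  then show ?thesis
    using eq word_split[OF fin, of \<pi> i] iA by (intro bexI[of _ i]) auto
qed

section \<open>Generating function of a preimage under stack-sorting\<close>

lemma finite_stack_sort_preimage: "finite {\<sigma>. stack_sort \<sigma> = w}"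
  by (rule finite_subset[OF _ mset_eq_finite[of w]]) (auto simp: mset_stack_sort)

definition preimage_gf :: "nat list \<Rightarrow> real fps"
  where "preimage_gf w = (\<Sum>\<sigma> | stack_sort \<sigma> = w. fps_X ^ card (valleys \<sigma>))"

lemma preimage_gf_nth: "fps_nth (preimage_gf w) p = card {\<sigma>. stack_sort \<sigma> = w \<and> card (valleys \<sigma>) = p}"
proof -
  have "fps_nth (preimage_gf w) p = (\<Sum>\<sigma> | stack_sort \<sigma> = w. if card (valleys \<sigma>) = p then 1 else 0)"
    by (auto simp: preimage_gf_def fps_sum_nth fps_X_power_nth intro!: sum.cong)
  also have "\<dots> = card ({\<sigma>. stack_sort \<sigma> = w} \<inter> {\<sigma>. card (valleys \<sigma>) = p})"
    using finite_stack_sort_preimage by (simp add: sum.If_cases)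
  finally show ?thesis by (simp add: Collect_conj_eq)
qed

lemma stack_sort_eq_Nil: "stack_sort \<sigma> = [] \<longleftrightarrow> \<sigma> = []"
  by (metis length_0_conv length_stack_sort)

lemma preimage_gf_Nil: "preimage_gf [] = 1"
  by (simp add: preimage_gf_def stack_sort_eq_Nil card_valleys_Nil)

lemma stack_sort_eq_single: "stack_sort \<sigma> = [m] \<longleftrightarrow> \<sigma> = [m]"
  by (metis mset_stack_sort mset_single_iff)

lemma preimage_gf_single: "preimage_gf [m] = fps_X"
  by (simp add: preimage_gf_def stack_sort_eq_single card_valleys_single)

lemma preimage_gf_not_max:
  assumes "distinct (u @ [m])" "x \<in> set u" "m < x"
  shows "preimage_gf (u @ [m]) = 0"
proof -
  have "stack_sort \<sigma> \<noteq> u @ [m]" for \<sigma>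
    using stack_sort_snocD(1)[OF _ assms(1), of \<sigma>] assms(2,3) by (meson order.asym)
  then show ?thesis unfolding preimage_gf_def by simp
qed

text \<open>The largest entry of \<sigma> is the root of the decreasing tree, and the cut
  \<open>i\<close> separates the postorders of its two subtrees. For empty \<open>A\<close> the
  identity would fail, because a lone entry is itself a valley.\<close>

lemma preimage_gf_word_insert_max:
  assumes fin: "finite A" and "A \<noteq> {}" and inj: "inj_on \<pi> (insert m A)"
    and m: "\<forall>i\<in>A. 0 < i \<and> i < m \<and> \<pi> i < \<pi> m"
  shows "preimage_gf (word \<pi> (insert m A)) =
    (\<Sum>i\<in>insert 0 A. preimage_gf (word \<pi> (A \<inter> {..i})) * preimage_gf (word \<pi> (A \<inter> {i<..})))"
proof -
  define pre where "pre w = {\<sigma>. stack_sort \<sigma> = w}" for w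
  define lo where "lo i = word \<pi> (A \<inter> {..i})" for i
  define hi where "hi i = word \<pi> (A \<inter> {i<..})" for i
  define join where "join = (\<lambda>(L, R). L @ \<pi> m # R)"
  have w: "word \<pi> (insert m A) = word \<pi> A @ [\<pi> m]" using m fin by (intro word_insert_max) auto
  have finpre: "finite (pre w)" for w by (simp add: pre_def finite_stack_sort_preimage)
  have setpre: "set \<sigma> = set w" if "\<sigma> \<in> pre w" for \<sigma> w
    using that set_stack_sort[of \<sigma>] by (simp add: pre_def)
  have lenlo: "length \<sigma> = card (A \<inter> {..i})" if "\<sigma> \<in> pre (lo i)" for \<sigma> i
    using that length_stack_sort[of \<sigma>] by (simp add: pre_def lo_def length_word)
  have card_less: "card (A \<inter> {..i}) < card (A \<inter> {..j})" if "i < j" "j \<in> A" for i j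
  proof (rule psubset_card_mono)
    have "j \<in> A \<inter> {..j}" "j \<notin> A \<inter> {..i}" using that by auto
    moreover have "A \<inter> {..i} \<subseteq> A \<inter> {..j}" using that by auto
    ultimately show "A \<inter> {..i} \<subset> A \<inter> {..j}" by blast
  qed (simp add: fin)
  have small: "x < \<pi> m" if "x \<in> set L \<union> set R" "L \<in> pre (lo i)" "R \<in> pre (hi i)" for x L R i
    using that m fin setpre[of L] setpre[of R] by (auto simp: lo_def hi_def set_word)
  have "pre (word \<pi> (insert m A)) = (\<Union>i\<in>insert 0 A. join ` (pre (lo i) \<times> pre (hi i)))"
  proof (intro set_eqI iffI)
    fix \<sigma> assume "\<sigma> \<in> pre (word \<pi> (insert m A))"
    then have "stack_sort \<sigma> = word \<pi> A @ [\<pi> m]" using w by (simp add: pre_def)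
    moreover have "distinct (word \<pi> A @ [\<pi> m])" using distinct_word[OF inj] w by simp
    ultimately obtain L R where LR: "\<sigma> = L @ \<pi> m # R" "stack_sort L @ stack_sort R = word \<pi> A"
      using stack_sort_snocD(2) by metis
    then obtain i where "i \<in> insert 0 A" "stack_sort L = lo i" "stack_sort R = hi i"
      using append_eq_wordD[OF fin LR(2)] m unfolding lo_def hi_def by blast
    then show "\<sigma> \<in> (\<Union>i\<in>insert 0 A. join ` (pre (lo i) \<times> pre (hi i)))"
      using LR(1) by (force simp: pre_def join_def)
  next
    fix \<sigma> assume "\<sigma> \<in> (\<Union>i\<in>insert 0 A. join ` (pre (lo i) \<times> pre (hi i)))"
    then obtain i L R where *: "\<sigma> = L @ \<pi> m # R" "L \<in> pre (lo i)" "R \<in> pre (hi i)"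
      by (auto simp: join_def)
    have "stack_sort \<sigma> = lo i @ hi i @ [\<pi> m]"
      using * small[of _ L R i] stack_sort_max[of L R "\<pi> m"] by (auto simp: pre_def)
    then show "\<sigma> \<in> pre (word \<pi> (insert m A))"
      using w word_split[OF fin, of \<pi> i] by (simp add: pre_def lo_def hi_def)
  qed
  then have "preimage_gf (word \<pi> (insert m A)) =
      (\<Sum>\<sigma>\<in>(\<Union>i\<in>insert 0 A. join ` (pre (lo i) \<times> pre (hi i))). fps_X ^ card (valleys \<sigma>))"
    by (simp only: preimage_gf_def pre_def)
  also have "\<dots> = (\<Sum>i\<in>insert 0 A. \<Sum>\<sigma>\<in>join ` (pre (lo i) \<times> pre (hi i)). fps_X ^ card (valleys \<sigma>))"
  \<comment> \<open>Different cuts share no \<sigma>: \<open>\<pi> m\<close> occurs once, so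
    \<sigma> determines \<open>L\<close>, and the length of \<open>L\<close> determines
    \<open>i\<close>.\<close>
  proof (rule sum.UNION_disjoint)
    show "\<forall>i\<in>insert 0 A. \<forall>j\<in>insert 0 A. i \<noteq> j \<longrightarrow>
      join ` (pre (lo i) \<times> pre (hi i)) \<inter> join ` (pre (lo j) \<times> pre (hi j)) = {}"
    proof (intro ballI impI equals0I)
      fix i j \<sigma> assume ij: "i \<in> insert 0 A" "j \<in> insert 0 A" "i \<noteq> j"
        and \<sigma>: "\<sigma> \<in> join ` (pre (lo i) \<times> pre (hi i)) \<inter> join ` (pre (lo j) \<times> pre (hi j))"
      from \<sigma> obtain L R where 1: "\<sigma> = L @ \<pi> m # R" "L \<in> pre (lo i)" "R \<in> pre (hi i)"
        by (auto simp: join_def)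
      from \<sigma> obtain L' R' where 2: "\<sigma> = L' @ \<pi> m # R'" "L' \<in> pre (lo j)" "R' \<in> pre (hi j)"
        by (auto simp: join_def)
      note * = 1 2
      have "\<pi> m \<notin> set L" "\<pi> m \<notin> set R" "\<pi> m \<notin> set L'" "\<pi> m \<notin> set R'"
        using small[of _ L R i] small[of _ L' R' j] * by blast+
      then have "L = L'" using *(1,4) append_Cons_eq_iff[of "\<pi> m" L R L' R'] by simp
      then have "card (A \<inter> {..i}) = card (A \<inter> {..j})"
        using *(2,5) lenlo by metis
      then show False
        using ij card_less[of i j] card_less[of j i] by (cases i j rule: linorder_cases) auto
    qed
  qed (use fin finpre in auto)
  also have "\<dots> = (\<Sum>i\<in>insert 0 A. preimage_gf (lo i) * preimage_gf (hi i))"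
  proof (rule sum.cong[OF refl])
    fix i assume "i \<in> insert 0 A"
    have "inj_on join (pre (lo i) \<times> pre (hi i))"
    proof (rule inj_onI, clarify)
      fix L R L' R' assume *: "L \<in> pre (lo i)" "R \<in> pre (hi i)" "L' \<in> pre (lo i)" "R' \<in> pre (hi i)"
        "join (L, R) = join (L', R')"
      then have "length L = length L'" by (metis length_stack_sort mem_Collect_eq pre_def)
      then show "L = L' \<and> R = R'" using *(5) by (simp add: join_def)
    qed
    then have "(\<Sum>\<sigma>\<in>join ` (pre (lo i) \<times> pre (hi i)). fps_X ^ card (valleys \<sigma>)) =
        (\<Sum>x\<in>pre (lo i) \<times> pre (hi i). fps_X ^ card (valleys (join x)) :: real fps)"
      by (simp add: sum.reindex)
    also have "\<dots> = (\<Sum>(L, R)\<in>pre (lo i) \<times> pre (hi i).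
        fps_X ^ card (valleys L) * fps_X ^ card (valleys R))"
    proof (rule sum.cong[OF refl], clarify)
      fix L R assume *: "L \<in> pre (lo i)" "R \<in> pre (hi i)"
      have "set L = set (lo i)" "set R = set (hi i)" using * setpre by blast+
      then have "set L \<union> set R = set (word \<pi> A)"
        using word_split[OF fin, of \<pi> i] by (simp add: lo_def hi_def)
      then have "L \<noteq> [] \<or> R \<noteq> []" using \<open>A \<noteq> {}\<close> fin by (auto simp: set_word)
      moreover have "\<forall>x\<in>set L \<union> set R. x < \<pi> m" using small * by blast
      ultimately show "fps_X ^ card (valleys (join (L, R))) =
          fps_X ^ card (valleys L) * (fps_X ^ card (valleys R) :: real fps)"
        by (simp add: join_def card_valleys_max power_add)
    qed
    finally show "(\<Sum>\<sigma>\<in>join ` (pre (lo i) \<times> pre (hi i)). fps_X ^ card (valleys \<sigma>)) =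
        preimage_gf (lo i) * preimage_gf (hi i)"
      by (simp only: preimage_gf_def pre_def sum_product sum.cartesian_product)
  qed
  finally show ?thesis unfolding lo_def hi_def .
qed

section \<open>Counting unary-binary plane trees\<close>

text \<open>Classify the subsets of \<open>{0..m}\<close> with \<open>a + b + 1\<close> elements by
  the element \<open>k\<close> that has \<open>a\<close> of them below it and \<open>b\<close>
  above.\<close>

lemma sum_choose_mult_choose:
  "(\<Sum>k\<le>m. (k choose a) * ((m - k) choose b)) = Suc m choose Suc (a + b)"
proof (induction m arbitrary: b)
  case 0
  then show ?case by (cases a; cases b) auto
next
  case (Suc m)
  show ?case
  proof (cases b)
    case 0
    then show ?thesis using sum_choose_upper[of a "Suc m"] by (simp add: atMost_atLeast0)
  next
    case (Suc b')
    \<comment> \<open>Pascal's rule in the second factor; the term \<open>k = Suc m\<close> drops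
      out because \<open>b\<close> is positive.\<close>
    have "(\<Sum>k\<le>Suc m. (k choose a) * ((Suc m - k) choose b)) =
        (\<Sum>k\<le>m. (k choose a) * ((m - k) choose b') + (k choose a) * ((m - k) choose b))"
      by (simp add: Suc Suc_diff_le distrib_left)
    also have "\<dots> = Suc (Suc m) choose Suc (a + b)"
      by (simp add: sum.distrib Suc.IH) (simp add: Suc)
    finally show ?thesis .
  qed
qed

section \<open>Catalan numbers and their convolution\<close>

lemma catalan_eq: "Suc n * catalan n = (2 * n) choose n"
proof -
  have "Suc n * ((2 * n) choose Suc n) = n * ((2 * n) choose n)"
    using binomial_absorb_comp[of "2 * n" n] binomial_absorption[of n "2 * n"]
    by (simp add: mult_2)
  \<comment> \<open>Writing the central binomial coefficient as a multiple of \<open>Suc n\<close>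
    makes the \<open>div\<close> in the definition of \<open>catalan\<close> exact.\<close>
  then have "(2 * n) choose n = Suc n * (((2 * n) choose n) - ((2 * n) choose Suc n))"
    by (simp add: diff_mult_distrib2)
  then have "Suc n dvd (2 * n) choose n" by (metis dvd_triv_left)
  then show ?thesis by (simp add: catalan_def del: mult_Suc)
qed

lemma catalan_Suc_rec: "(n + 2) * catalan (Suc n) = 2 * (2 * n + 1) * catalan n"
proof -
  have bin: "Suc n * ((2 * Suc n) choose Suc n) = 2 * (2 * n + 1) * ((2 * n) choose n)"
  proof -
    have 1: "Suc n * ((2 * n + 2) choose Suc n) = (2 * n + 2) * ((2 * n + 1) choose n)"
      using Suc_times_binomial_eq[of "2 * n + 1" n] by (simp add: mult.commute)
    have 2: "Suc n * ((2 * n + 1) choose n) = (2 * n + 1) * ((2 * n) choose n)"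
      using binomial_absorb_comp[of "2 * n + 1" n] by simp
    have "(2 * n + 2) * ((2 * n + 1) choose n) = 2 * (Suc n * ((2 * n + 1) choose n))"
      by (simp add: algebra_simps)
    then show ?thesis using 1 2 by simp
  qed
  have "Suc n * ((n + 2) * catalan (Suc n)) = Suc n * ((2 * Suc n) choose Suc n)"
    unfolding catalan_eq[of "Suc n", symmetric] by simp
  also have "\<dots> = Suc n * (2 * (2 * n + 1) * catalan n)"
    unfolding bin catalan_eq[of n, symmetric] by (simp only: mult_ac)
  finally have "Suc n * ((n + 2) * catalan (Suc n)) = Suc n * (2 * (2 * n + 1) * catalan n)" .
  then show ?thesis by (metis mult_cancel1 nat.distinct(1))
qed

text \<open>Up to signs and powers of 4, the Taylor coefficients of (1 + x)^(1/2) are Catalan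
  numbers: the ratio of consecutive terms is the one of \<open>catalan_Suc_rec\<close> divided by
  -4.\<close>

lemma gchoose_half: "((1 / 2 :: real) gchoose Suc n) = 2 * (- 1) ^ n * real (catalan n) / 4 ^ Suc n"
proof (induction n)
  case 0
  then show ?case by (simp add: catalan_def)
next
  case (Suc n)
  have catR: "(real n + 2) * real (catalan (Suc n)) = 2 * (2 * real n + 1) * real (catalan n)"
    using arg_cong[OF catalan_Suc_rec[of n], of real] by (simp add: algebra_simps)
  define x where "x = 2 * (2 * real n + 1) / (real n + 2)"
  have cat: "real (catalan (Suc n)) = x * real (catalan n)"
    using catR by (simp add: x_def field_simps)
  have "((1 / 2 :: real) gchoose Suc (Suc n)) = (1 / 2 - real (Suc n)) / real (Suc (Suc n)) * (1 / 2 gchoose Suc n)"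
    using gbinomial_mult_1[of "1 / 2 :: real" "Suc n"] by (simp add: field_simps)
  also have "\<dots> = 2 * (- 1) ^ Suc n * real (catalan (Suc n)) / 4 ^ Suc (Suc n)"
  proof -
    have "(1 / 2 - real (Suc n)) / real (Suc (Suc n)) = - x / 4"
      by (simp add: x_def field_simps)
    then show ?thesis unfolding Suc cat by simp
  qed
  finally show ?case .
qed

text \<open>Vandermonde's identity for \<open>(1 + x)\<^sup>1\<^sup>/\<^sup>2 (1 + x)\<^sup>1\<^sup>/\<^sup>2 = 1 + x\<close>.\<close>

lemma catalan_Suc: "catalan (Suc n) = (\<Sum>k\<le>n. catalan k * catalan (n - k))"
proof -
  let ?g = "\<lambda>k. (1 / 2 :: real) gchoose k"
  have "(\<Sum>k\<le>Suc (Suc n). ?g k * ?g (Suc (Suc n) - k)) = (1 gchoose Suc (Suc n))"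
    using gbinomial_Vandermonde[of "1 / 2 :: real" "1 / 2" "Suc (Suc n)"] by (simp add: atMost_atLeast0)
  also have "\<dots> = 0"
    using binomial_gbinomial[of 1 "Suc (Suc n)", where 'a = real] by simp
  finally have "?g (Suc (Suc n)) + (\<Sum>k\<le>Suc n. ?g (Suc k) * ?g (Suc n - k)) = 0"
    by (simp add: sum.atMost_Suc_shift[of _ "Suc n"] del: sum.atMost_Suc)
  \<comment> \<open>The outermost terms of the Vandermonde sum are both
    \<open>?g (Suc (Suc n))\<close>, because \<open>?g 0 = 1\<close>.\<close>
  then have "2 * ?g (Suc (Suc n)) + (\<Sum>k\<le>n. ?g (Suc k) * ?g (Suc (n - k))) = 0"
    by (simp add: Suc_diff_le)
  also have "(\<Sum>k\<le>n. ?g (Suc k) * ?g (Suc (n - k))) =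
      (\<Sum>k\<le>n. 4 * (- 1) ^ n / 4 ^ Suc (Suc n) * (real (catalan k) * real (catalan (n - k))))"
  proof (intro sum.cong refl)
    fix k assume "k \<in> {..n}"
    then have "(- 1 :: real) ^ n = (- 1) ^ k * (- 1) ^ (n - k)" "(4 :: real) ^ n = 4 ^ k * 4 ^ (n - k)"
      by (simp_all flip: power_add)
    then show "?g (Suc k) * ?g (Suc (n - k)) =
        4 * (- 1) ^ n / 4 ^ Suc (Suc n) * (real (catalan k) * real (catalan (n - k)))"
      unfolding gchoose_half by simp
  qed
  finally have "2 * (2 * (- 1) ^ Suc n * real (catalan (Suc n)) / 4 ^ Suc (Suc n)) +
      4 * (- 1) ^ n / 4 ^ Suc (Suc n) * (\<Sum>k\<le>n. real (catalan k) * real (catalan (n - k))) = 0"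
    unfolding gchoose_half sum_distrib_left[symmetric] .
  then have "4 * (- 1) ^ n / 4 ^ Suc (Suc n) * real (catalan (Suc n)) =
      4 * (- 1) ^ n / 4 ^ Suc (Suc n) * (\<Sum>k\<le>n. real (catalan k) * real (catalan (n - k)))"
    by simp
  then have "real (catalan (Suc n)) = (\<Sum>k\<le>n. real (catalan k) * real (catalan (n - k)))"
    by simp
  then have "real (catalan (Suc n)) = real (\<Sum>k\<le>n. catalan k * catalan (n - k))"
    by simp
  then show ?thesis by (rule of_nat_eq_iff[THEN iffD1])
qed

text \<open>
  The number of unary-binary plane trees with \<open>n\<close> nodes and \<open>p\<close> leaves is the coefficient of
  \<open>x\<^sup>p\<close>. For \<open>n = 0\<close> the value is junk.
\<close>

definition unary_binary_gf :: "nat \<Rightarrow> real fps"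
  where "unary_binary_gf n =
    Abs_fps (\<lambda>p. if p = 0 then 0 else real (((n - 1) choose (2 * p - 2)) * catalan (p - 1)))"

lemma unary_binary_gf_nth_0: "fps_nth (unary_binary_gf n) 0 = 0"
  by (simp add: unary_binary_gf_def)

lemma unary_binary_gf_1: "unary_binary_gf 1 = fps_X"
proof (rule fps_ext)
  fix p show "fps_nth (unary_binary_gf 1) p = fps_nth fps_X p"
  proof (cases "p \<le> 1")
    case True
    then show ?thesis by (cases p) (auto simp: unary_binary_gf_def catalan_def)
  next
    case False
    then have "0 < 2 * p - 2" by simp
    then show ?thesis using False by (auto simp: unary_binary_gf_def binomial_eq_0)
  qed
qed

text \<open>Removing the root of a tree with \<open>n + 1\<close> nodes leaves either one subtree
  with \<open>n\<close> nodes or an ordered pair with \<open>n\<close> nodes in total. For the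
  closed formula this is Pascal's rule combined with the Catalan convolution and
  \<open>sum_choose_mult_choose\<close>.\<close>

lemma unary_binary_gf_rec:
  assumes "1 \<le> n"
  shows "unary_binary_gf (Suc n) = unary_binary_gf n +
    (\<Sum>k = 1..<n. unary_binary_gf k * unary_binary_gf (n - k))"
proof (rule fps_ext)
  fix p
  let ?M = "\<lambda>n. fps_nth (unary_binary_gf n)"
  have rhs: "fps_nth (unary_binary_gf n + (\<Sum>k = 1..<n. unary_binary_gf k * unary_binary_gf (n - k))) p
      = ?M n p + (\<Sum>k = 1..<n. \<Sum>i = 0..p. ?M k i * ?M (n - k) (p - i))"
    by (simp add: fps_sum_nth fps_mult_nth)
  have M0: "?M k 0 = 0" for k by (simp add: unary_binary_gf_def)
  show "?M (Suc n) p = fps_nth (unary_binary_gf n +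
      (\<Sum>k = 1..<n. unary_binary_gf k * unary_binary_gf (n - k))) p"
  proof (cases "p \<le> 1")
    case True
    then consider "p = 0" | "p = 1" by linarith
    then have "?M (Suc n) p = ?M n p"
      by cases (simp_all add: unary_binary_gf_def)
    moreover have M_zero: "?M k i * ?M (n - k) (p - i) = 0" if "i \<in> {0..p}" for i k
      using that True M0 by (cases "i = 0") auto
    then have "(\<Sum>k = 1..<n. \<Sum>i = 0..p. ?M k i * ?M (n - k) (p - i)) = 0"
      by (intro sum.neutral ballI) (rule M_zero)
    ultimately show ?thesis unfolding rhs by simp
  next
    case False
    then obtain r where r: "p = r + 2" by (metis add.commute le_Suc_ex nat_le_linear not_less_eq_eq one_add_one plus_1_eq_Suc)
    obtain m where m: "n = Suc m" using assms by (cases n) auto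
    have "(\<Sum>k = 1..<n. \<Sum>i = 0..p. ?M k i * ?M (n - k) (p - i)) =
        (\<Sum>i = 0..p. \<Sum>k = 1..<n. ?M k i * ?M (n - k) (p - i))"
      by (rule sum.swap)
    \<comment> \<open>Both subtrees have at least one leaf, so \<open>i = 0\<close> and
      \<open>i = p\<close> contribute nothing.\<close>
    also have "\<dots> = (\<Sum>i\<in>{1..Suc r}. \<Sum>k = 1..<n. ?M k i * ?M (n - k) (p - i))"
    proof (rule sum.mono_neutral_right)
      show "\<forall>i\<in>{0..p} - {1..Suc r}. (\<Sum>k = 1..<n. ?M k i * ?M (n - k) (p - i)) = 0"
      proof
        fix i assume "i \<in> {0..p} - {1..Suc r}"
        then have "i = 0 \<or> i = p" using r by auto
        then show "(\<Sum>k = 1..<n. ?M k i * ?M (n - k) (p - i)) = 0" using M0 by auto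
      qed
    qed (use r in auto)
    also have "\<dots> = (\<Sum>a\<le>r. \<Sum>k = 1..<n. ?M k (Suc a) * ?M (n - k) (Suc (r - a)))"
      by (rule sum.reindex_bij_witness[of _ Suc "\<lambda>i. i - 1"]) (auto simp: r Suc_diff_le)
    also have "\<dots> = (\<Sum>a\<le>r. real ((m choose (2 * r + 1)) * (catalan a * catalan (r - a))))"
    proof (intro sum.cong refl)
      fix a assume a: "a \<in> {..r}"
      have "(\<Sum>k = 1..<n. ?M k (Suc a) * ?M (n - k) (Suc (r - a))) =
          (\<Sum>k = 1..<n. real (((k - 1) choose (2 * a)) * ((m - k) choose (2 * (r - a)))) * real (catalan a * catalan (r - a)))"
        by (simp add: unary_binary_gf_def m mult_ac)
      also have "\<dots> = (\<Sum>k = 1..<n. real (((k - 1) choose (2 * a)) * ((m - k) choose (2 * (r - a))))) * real (catalan a * catalan (r - a))"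
        by (rule sum_distrib_right[symmetric])
      also have "(\<Sum>k = 1..<n. real (((k - 1) choose (2 * a)) * ((m - k) choose (2 * (r - a))))) = real (m choose (2 * r + 1))"
      proof (cases m)
        case 0
        then show ?thesis by (simp add: m)
      next
        case (Suc l)
        have "(\<Sum>k = 1..<n. real (((k - 1) choose (2 * a)) * ((m - k) choose (2 * (r - a))))) =
            (\<Sum>k\<le>l. real ((k choose (2 * a)) * ((l - k) choose (2 * (r - a)))))"
          by (rule sum.reindex_bij_witness[of _ Suc "\<lambda>k. k - 1"]) (auto simp: m Suc)
        also have "\<dots> = real (Suc l choose Suc (2 * a + 2 * (r - a)))"
          by (simp only: sum_choose_mult_choose flip: of_nat_sum)
        also have "Suc l choose Suc (2 * a + 2 * (r - a)) = m choose (2 * r + 1)"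
        proof -
          have "2 * a + 2 * (r - a) = 2 * r" using a by auto
          then show ?thesis by (simp only: Suc Suc_eq_plus1)
        qed
        finally show ?thesis .
      qed
      finally show "(\<Sum>k = 1..<n. ?M k (Suc a) * ?M (n - k) (Suc (r - a))) =
          real ((m choose (2 * r + 1)) * (catalan a * catalan (r - a)))" by simp
    qed
    \<comment> \<open>Together with \<open>?M n p\<close>, whose binomial is
      \<open>m choose (2 * r + 2)\<close>, Pascal's rule then produces
      \<open>Suc m choose (2 * r + 2)\<close>.\<close>
    also have "\<dots> = real ((m choose (2 * r + 1)) * catalan (Suc r))"
      by (simp only: catalan_Suc sum_distrib_left of_nat_sum)
    finally show ?thesis unfolding rhs
      by (simp add: unary_binary_gf_def r m distrib_right)
  qed
qed

section \<open>Decreasing trees\<close>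

text \<open>
  The coefficient of \<open>x\<^sup>p\<close> is divided by \<open>2\<^sup>n\<^sup>+\<^sup>1\<^sup>-\<^sup>2\<^sup>p\<close>, the number of orientations of the
  single children, so that unary-binary trees are counted. The resulting value \<open>1/2\<close> for the empty
  tree makes the recursion uniform: a single child appears once on the left and once on the right.
\<close>

definition tree_gf :: "(nat \<Rightarrow> nat) \<Rightarrow> nat set \<Rightarrow> real fps"
  where "tree_gf \<pi> A =
    fps_const (1 / 2 ^ Suc (card A)) * (preimage_gf (word \<pi> A) oo (fps_const 4 * fps_X))"

lemma preimage_gf_nth_tree_gf:
  "fps_nth (preimage_gf (word \<pi> A)) p = 2 ^ Suc (card A) / 4 ^ p * fps_nth (tree_gf \<pi> A) p"
  by (simp add: tree_gf_def)

lemma tree_gf_empty: "tree_gf \<pi> {} = fps_const (1 / 2)"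
  by (simp add: tree_gf_def word_def preimage_gf_Nil)

lemma tree_gf_single: "tree_gf \<pi> {m} = fps_X"
proof -
  have "fps_const (1 / 2 ^ Suc (card {m})) * (fps_const 4 * fps_X) = (fps_X :: real fps)"
    by (simp flip: mult.assoc)
  then show ?thesis
    by (simp add: tree_gf_def word_def preimage_gf_single)
qed

text \<open>The normalization has exponent \<open>card + 1\<close>, and
  \<open>card A + 2 = (a + 1) + (b + 1)\<close> for the sizes \<open>a\<close> and \<open>b\<close>
  of the two parts, so removing the root costs no factor.\<close>

lemma tree_gf_insert_max:
  assumes fin: "finite A" and "A \<noteq> {}" and inj: "inj_on \<pi> (insert m A)"
    and m: "\<forall>i\<in>A. 0 < i \<and> i < m \<and> \<pi> i < \<pi> m"
  shows "tree_gf \<pi> (insert m A) =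
    (\<Sum>i\<in>insert 0 A. tree_gf \<pi> (A \<inter> {..i}) * tree_gf \<pi> (A \<inter> {i<..}))"
proof -
  let ?c = "fps_const 4 * fps_X :: real fps"
  have c0: "fps_nth ?c 0 = 0" by simp
  have "m \<notin> A" using m by auto
  have "tree_gf \<pi> (insert m A) = fps_const (1 / 2 ^ Suc (Suc (card A))) *
      (\<Sum>i\<in>insert 0 A. (preimage_gf (word \<pi> (A \<inter> {..i})) oo ?c) * (preimage_gf (word \<pi> (A \<inter> {i<..})) oo ?c))"
    unfolding tree_gf_def preimage_gf_word_insert_max[OF assms] fps_compose_sum_distrib
      fps_compose_mult_distrib[OF c0]
    using fin \<open>m \<notin> A\<close> by simp
  also have "\<dots> = (\<Sum>i\<in>insert 0 A. tree_gf \<pi> (A \<inter> {..i}) * tree_gf \<pi> (A \<inter> {i<..}))"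
    unfolding sum_distrib_left
  proof (rule sum.cong[OF refl])
    fix i
    have "card A = card (A \<inter> {..i}) + card (A \<inter> {i<..})"
      using fin by (subst card_Un_disjoint[symmetric]) (auto intro: arg_cong[of _ _ card])
    then have "fps_const (1 / 2 ^ Suc (Suc (card A))) =
        fps_const (1 / 2 ^ Suc (card (A \<inter> {..i}))) * fps_const (1 / 2 ^ Suc (card (A \<inter> {i<..})) :: real)"
      by (simp add: power_add)
    then show "fps_const (1 / 2 ^ Suc (Suc (card A))) *
        ((preimage_gf (word \<pi> (A \<inter> {..i})) oo ?c) * (preimage_gf (word \<pi> (A \<inter> {i<..})) oo ?c)) =
        tree_gf \<pi> (A \<inter> {..i}) * tree_gf \<pi> (A \<inter> {i<..})"
      unfolding tree_gf_def by (simp only: mult_ac)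
  qed
  finally show ?thesis .
qed

lemma tree_gf_last_not_max:
  assumes fin: "finite A" and inj: "inj_on \<pi> (insert m A)" and "\<forall>i\<in>A. i < m"
    and y: "y \<in> A" "\<pi> m < \<pi> y"
  shows "tree_gf \<pi> (insert m A) = 0"
proof -
  have w: "word \<pi> (insert m A) = word \<pi> A @ [\<pi> m]" using assms by (intro word_insert_max) auto
  have "preimage_gf (word \<pi> A @ [\<pi> m]) = 0"
    using distinct_word[OF inj] y fin unfolding w
    by (intro preimage_gf_not_max[of _ _ "\<pi> y"]) (auto simp: set_word)
  then show ?thesis by (simp add: tree_gf_def w)
qed

text \<open>In an increasing word the last entry of every part is its maximum, so no cut is excluded
  at any stage and only the sizes of the parts matter: \<open>tree_gf\<close> obeys the recursion of
  \<open>unary_binary_gf\<close>.\<close>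

lemma tree_gf_increasing:
  assumes "finite A" "A \<noteq> {}" "strict_mono_on A \<pi>" "0 \<notin> A"
  shows "tree_gf \<pi> A = unary_binary_gf (card A)"
proof -
  \<comment> \<open>\<open>M\<close> replaces the junk value \<open>unary_binary_gf 0\<close> by
    1/2, the value of \<open>tree_gf\<close> at the empty set.\<close>
  define M where "M n = (if n = 0 then fps_const (1 / 2) else unary_binary_gf n)" for n
  have "tree_gf \<pi> A = M (card A)"
    using assms(1,3,4)
  proof (induction "card A" arbitrary: A rule: less_induct)
    case less
    show ?case
    proof (cases "A = {}")
      case True
      then show ?thesis by (simp add: tree_gf_empty M_def)
    next
      case False
      define m where "m = Max A"
      define B where "B = A - {m}"
      have "m \<in> A" using False less.prems by (simp add: m_def)
      then have A: "A = insert m B" "m \<notin> B" by (auto simp: B_def)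
      have finB: "finite B" using less.prems by (simp add: B_def)
      have B: "0 < i \<and> i < m \<and> \<pi> i < \<pi> m" if "i \<in> B" for i
      proof -
        have "i \<in> A" "i \<noteq> m" using that by (auto simp: B_def)
        then have "i < m" using less.prems(1) Max_ge[of A i] by (simp add: m_def le_neq_implies_less)
        moreover have "0 < i" using \<open>i \<in> A\<close> less.prems(3) by (cases i) auto
        ultimately show ?thesis using \<open>i \<in> A\<close> \<open>m \<in> A\<close> less.prems(2) by (simp add: strict_mono_on_def)
      qed
      show ?thesis
      proof (cases "B = {}")
        case True
        then show ?thesis using A unary_binary_gf_1 by (simp add: tree_gf_single M_def)
      next
        case False
        have inj: "inj_on \<pi> (insert m B)"
          using strict_mono_on_imp_inj_on[OF less.prems(2)] A(1) by metis
        have IH: "tree_gf \<pi> C = M (card C)" if "C \<subseteq> B" for C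
        proof (rule less.hyps)
          have "card C \<le> card B" using that finB by (simp add: card_mono)
          then show "card C < card A" using A finB by simp
          show "finite C" using that finB finite_subset by blast
          show "strict_mono_on C \<pi>"
            using that less.prems(2) A(1) unfolding strict_mono_on_def by blast
          show "0 \<notin> C" using that less.prems(3) A by auto
        qed
        have card_split: "card B = card (B \<inter> {..i}) + card (B \<inter> {i<..})" for i
          using finB by (subst card_Un_disjoint[symmetric]) (auto intro: arg_cong[of _ _ card])
        have bij: "bij_betw (\<lambda>i. card (B \<inter> {..i})) (insert 0 B) {..card B}"
        proof -
          have less: "card (B \<inter> {..i}) < card (B \<inter> {..j})" if "i < j" "j \<in> B" for i j
          proof (rule psubset_card_mono)
            have "j \<in> B \<inter> {..j}" "j \<notin> B \<inter> {..i}" using that by auto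
            moreover have "B \<inter> {..i} \<subseteq> B \<inter> {..j}" using that by auto
            ultimately show "B \<inter> {..i} \<subset> B \<inter> {..j}" by blast
          qed (simp add: finB)
          have inj: "inj_on (\<lambda>i. card (B \<inter> {..i})) (insert 0 B)"
          proof (rule inj_onI)
            fix i j assume "i \<in> insert 0 B" "j \<in> insert 0 B" "card (B \<inter> {..i}) = card (B \<inter> {..j})"
            then show "i = j" using less[of i j] less[of j i]
              by (cases i j rule: linorder_cases) auto
          qed
          have sub: "(\<lambda>i. card (B \<inter> {..i})) ` insert 0 B \<subseteq> {..card B}"
            using finB by (auto intro: card_mono)
          have "0 \<notin> B" using B by blast
          then have "card ((\<lambda>i. card (B \<inter> {..i})) ` insert 0 B) = card {..card B}"
            using finB by (subst card_image[OF inj]) simp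
          then show ?thesis unfolding bij_betw_def
            using inj sub by (meson card_subset_eq finite_atMost)
        qed
        obtain n where n: "card B = Suc n" using False finB by (metis card_eq_0_iff not0_implies_Suc)
        have "tree_gf \<pi> A = (\<Sum>i\<in>insert 0 B. tree_gf \<pi> (B \<inter> {..i}) * tree_gf \<pi> (B \<inter> {i<..}))"
          unfolding A(1) using B by (intro tree_gf_insert_max[OF finB False inj]) blast
        also have "\<dots> = (\<Sum>i\<in>insert 0 B. M (card (B \<inter> {..i})) * M (card B - card (B \<inter> {..i})))"
        proof (rule sum.cong[OF refl])
          fix i show "tree_gf \<pi> (B \<inter> {..i}) * tree_gf \<pi> (B \<inter> {i<..}) =
              M (card (B \<inter> {..i})) * M (card B - card (B \<inter> {..i}))"
            using IH[of "B \<inter> {..i}"] IH[of "B \<inter> {i<..}"] card_split[of i] by simp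
        qed
        also have "\<dots> = (\<Sum>k\<le>card B. M k * M (card B - k))"
          using sum.reindex_bij_betw[OF bij, of "\<lambda>k. M k * M (card B - k)"] by simp
        \<comment> \<open>The extreme sizes belong to roots with a single child, on the right or on
          the left. Each carries the weight 1/2 of its empty side, and together they give the unary
          term.\<close>
        also have "{..card B} = insert 0 (insert (card B) {1..<card B})"
          using n by auto
        also have "(\<Sum>k\<in>\<dots>. M k * M (card B - k)) = M 0 * M (card B) + (M (card B) * M 0 +
            (\<Sum>k = 1..<card B. M k * M (card B - k)))"
          using n by simp
        also have "(\<Sum>k = 1..<card B. M k * M (card B - k)) =
            (\<Sum>k = 1..<card B. unary_binary_gf k * unary_binary_gf (card B - k))"
          by (intro sum.cong refl) (simp add: M_def)
        also have "M 0 * M (card B) + (M (card B) * M 0 + \<dots>) =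
            fps_const (1/2) * M (card B) + fps_const (1/2) * M (card B) + \<dots>"
          by (simp add: M_def mult.commute)
        also have "fps_const (1/2) * M (card B) + fps_const (1/2) * M (card B) = M (card B)"
          by (simp flip: distrib_right)
        also have "M (card B) + (\<Sum>k = 1..<card B. unary_binary_gf k * unary_binary_gf (card B - k)) =
            unary_binary_gf (Suc (card B))"
          using n by (subst unary_binary_gf_rec) (simp_all add: M_def)
        also have "\<dots> = M (card A)" using A finB by (simp add: M_def)
        finally show ?thesis .
      qed
    qed
  qed
  then show ?thesis using assms by (simp add: M_def)
qed

text \<open>Instead of cutting trees at \<open>j\<close>, the root \<open>m = Max A\<close> is
  removed on both sides. If the root's cut is not at \<open>d\<close>, induction applies to the
  subtree that contains \<open>d\<close>; the cut at \<open>d\<close> makes \<open>d\<close> a child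
  of the root, so that \<open>j = m\<close>. The last assumption speaks of all inversions because in
  this form it passes to subsets of \<open>A\<close> at once.\<close>

lemma tree_gf_descent:
  assumes "finite A" "0 \<notin> A" "inj_on \<pi> A" "d \<in> A" "e \<in> A" "d < e" "\<pi> e < \<pi> d"
    and "A \<inter> {d<..<e} = {}"
    and "\<forall>a\<in>A. \<forall>b\<in>A. a < b \<and> \<pi> b < \<pi> a \<longrightarrow> \<pi> a \<le> \<pi> d"
  shows "tree_gf \<pi> A =
    (\<Sum>j | j \<in> A \<and> d < j \<and> \<pi> d < \<pi> j. tree_gf \<pi> (A - {d<..j}) * tree_gf \<pi> (A \<inter> {d<..<j}))"
  using assms
proof (induction "card A" arbitrary: A rule: less_induct)
  case less
  define J where "J A = {j. j \<in> A \<and> d < j \<and> \<pi> d < \<pi> j}" for A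
  define m where "m = Max A"
  define B where "B = A - {m}"
  note dA = less.prems(4) and eA = less.prems(5) and dom = less.prems(9)
  have mA: "m \<in> A" using dA less.prems(1) unfolding m_def by (intro Max_in) auto
  then have A: "A = insert m B" "m \<notin> B" by (auto simp: B_def)
  have finB: "finite B" using less.prems by (simp add: B_def)
  have B: "0 < i \<and> i < m" if "i \<in> B" for i
  proof -
    have "i \<in> A" "i \<noteq> m" using that by (auto simp: B_def)
    then show ?thesis using less.prems(1,2) Max_ge[of A i] unfolding m_def
      by (metis gr0I le_neq_implies_less)
  qed
  have "e \<le> m" using less.prems(1) eA by (simp add: m_def)
  then have "d \<noteq> m" using less.prems(6) by simp
  then have dB: "d \<in> B" using dA by (simp add: B_def)
  show ?case
  \<comment> \<open>If the last entry is not the largest, no tree has this postorder. The sum on the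
    right is then empty too: any \<open>j\<close> in it would form an inversion with
    \<open>m\<close> whose top is higher than \<open>\<pi> d\<close>.\<close>
  proof (cases "\<exists>y\<in>B. \<pi> m < \<pi> y")
    case True
    then obtain y where y: "y \<in> B" "\<pi> m < \<pi> y" by blast
    then have "\<pi> y \<le> \<pi> d" using dom B A by blast
    have "J A = {}"
    proof (rule ccontr)
      assume "J A \<noteq> {}"
      then obtain j where j: "j \<in> A" "d < j" "\<pi> d < \<pi> j" by (auto simp: J_def)
      then have "j \<noteq> m" using y \<open>\<pi> y \<le> \<pi> d\<close> by auto
      then have "j < m" using j A B by auto
      moreover have "\<pi> m < \<pi> j" using y j \<open>\<pi> y \<le> \<pi> d\<close> by simp
      ultimately have "\<pi> j \<le> \<pi> d" using dom j mA by blast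
      then show False using j by simp
    qed
    moreover have "tree_gf \<pi> A = 0"
      unfolding A(1) using y finB less.prems(3) A B by (intro tree_gf_last_not_max[of B \<pi> m y]) auto
    ultimately have "tree_gf \<pi> A = (\<Sum>j\<in>J A. tree_gf \<pi> (A - {d<..j}) * tree_gf \<pi> (A \<inter> {d<..<j}))"
      by simp
    then show ?thesis unfolding J_def .
  next
    case False
    have Bm: "\<pi> i < \<pi> m" if "i \<in> B" for i
      using False that less.prems(3) A by (metis inj_on_contraD insertCI linorder_neqE_nat)
    have "e \<noteq> m" using Bm[OF dB] less.prems(7) by auto
    then have eB: "e \<in> B" using eA by (simp add: B_def)
    have inj: "inj_on \<pi> (insert m C)" if "C \<subseteq> B" for C
      using less.prems(3) A that by (auto intro: inj_on_subset)
    have IH: "tree_gf \<pi> C = (\<Sum>j\<in>J C. tree_gf \<pi> (C - {d<..j}) * tree_gf \<pi> (C \<inter> {d<..<j}))"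
      if "C \<subseteq> B" "d \<in> C" "e \<in> C" for C
      unfolding J_def
    proof (rule less.hyps)
      have "card C \<le> card B" using that finB by (simp add: card_mono)
      then show "card C < card A" using A finB by simp
      show "finite C" using that finB finite_subset by blast
      show "inj_on \<pi> C" using inj[OF that(1)] by simp
      show "C \<inter> {d<..<e} = {}" using less.prems(8) that A by blast
      show "\<forall>a\<in>C. \<forall>b\<in>C. a < b \<and> \<pi> b < \<pi> a \<longrightarrow> \<pi> a \<le> \<pi> d"
        using dom that A by blast
    qed (use that less.prems A in auto)
    have rec: "tree_gf \<pi> (insert m C) =
        (\<Sum>i\<in>insert 0 C. tree_gf \<pi> (C \<inter> {..i}) * tree_gf \<pi> (C \<inter> {i<..}))"
      if "C \<subseteq> B" "C \<noteq> {}" for C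
      using that B Bm finB inj[OF that(1)] by (intro tree_gf_insert_max) (auto intro: finite_subset)
    let ?t = "tree_gf \<pi>"
    \<comment> \<open>Cuts in \<open>I\<close> leave \<open>d\<close> in the right subtree, cuts in
      \<open>K\<close> leave it in the left one; \<open>0\<close> in \<open>I\<close> is the empty
      left subtree.\<close>
    define I where "I = {i\<in>insert 0 B. i < d}"
    define K where "K = {i\<in>B. d < i}"
    have fin: "finite I" "finite K" "finite (J B)" using finB by (auto simp: I_def K_def J_def)
    have d0: "0 < d" using B dB by blast
    have "tree_gf \<pi> A = (\<Sum>i\<in>insert 0 B. ?t (B \<inter> {..i}) * ?t (B \<inter> {i<..}))"
      unfolding A(1) using dB by (intro rec) auto
    also have "insert 0 B = I \<union> ({d} \<union> K)"
      using dB d0 by (auto simp: I_def K_def)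
    also have "(\<Sum>i\<in>\<dots>. ?t (B \<inter> {..i}) * ?t (B \<inter> {i<..})) =
        (\<Sum>i\<in>I. ?t (B \<inter> {..i}) * ?t (B \<inter> {i<..})) + (?t (B \<inter> {..d}) * ?t (B \<inter> {d<..}) +
        (\<Sum>i\<in>K. ?t (B \<inter> {..i}) * ?t (B \<inter> {i<..})))"
      using fin by (subst sum.union_disjoint) (auto simp: I_def K_def)
    also have "(\<Sum>i\<in>I. ?t (B \<inter> {..i}) * ?t (B \<inter> {i<..})) =
        (\<Sum>j\<in>J B. (\<Sum>i\<in>I. ?t (B \<inter> {..i}) * ?t (B \<inter> {i<..} - {d<..j})) * ?t (B \<inter> {d<..<j}))"
    proof -
      have "(\<Sum>i\<in>I. ?t (B \<inter> {..i}) * ?t (B \<inter> {i<..})) =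
          (\<Sum>i\<in>I. \<Sum>j\<in>J B. ?t (B \<inter> {..i}) * (?t (B \<inter> {i<..} - {d<..j}) * ?t (B \<inter> {d<..<j})))"
      proof (rule sum.cong[OF refl])
        fix i assume "i \<in> I"
        then have i: "i < d" by (simp add: I_def)
        then have "J (B \<inter> {i<..}) = J B" by (auto simp: J_def)
        moreover have "B \<inter> {i<..} \<inter> {d<..<j} = B \<inter> {d<..<j}" for j using i by auto
        ultimately show "?t (B \<inter> {..i}) * ?t (B \<inter> {i<..}) =
            (\<Sum>j\<in>J B. ?t (B \<inter> {..i}) * (?t (B \<inter> {i<..} - {d<..j}) * ?t (B \<inter> {d<..<j})))"
          using IH[of "B \<inter> {i<..}"] i dB eB less.prems(6) by (simp add: sum_distrib_left)
      qed
      also have "\<dots> = (\<Sum>j\<in>J B. \<Sum>i\<in>I. ?t (B \<inter> {..i}) * (?t (B \<inter> {i<..} - {d<..j}) * ?t (B \<inter> {d<..<j})))"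
        by (rule sum.swap)
      finally show ?thesis by (simp only: sum_distrib_right mult.assoc)
    qed
    also have "(\<Sum>i\<in>K. ?t (B \<inter> {..i}) * ?t (B \<inter> {i<..})) =
        (\<Sum>j\<in>J B. (\<Sum>i\<in>{i\<in>K. j \<le> i}. ?t (B \<inter> {..i} - {d<..j}) * ?t (B \<inter> {i<..})) * ?t (B \<inter> {d<..<j}))"
    proof -
      have "(\<Sum>i\<in>K. ?t (B \<inter> {..i}) * ?t (B \<inter> {i<..})) =
          (\<Sum>i\<in>K. \<Sum>j\<in>{j\<in>J B. j \<le> i}. ?t (B \<inter> {..i} - {d<..j}) * ?t (B \<inter> {d<..<j}) * ?t (B \<inter> {i<..}))"
      proof (rule sum.cong[OF refl])
        fix i assume "i \<in> K"
        then have i: "d < i" "i \<in> B" by (simp_all add: K_def)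
        \<comment> \<open>The successor \<open>e\<close> of \<open>d\<close> falls into the same
          part as \<open>d\<close>, which is what the induction hypothesis asks for.\<close>
        then have ei: "e \<le> i" using less.prems(8) A by (meson disjoint_iff greaterThanLessThan_iff insertI2 not_le_imp_less)
        have "?t (B \<inter> {..i}) = (\<Sum>j\<in>J (B \<inter> {..i}). ?t (B \<inter> {..i} - {d<..j}) * ?t (B \<inter> {..i} \<inter> {d<..<j}))"
          using IH[of "B \<inter> {..i}"] i dB eB ei by simp
        also have "\<dots> = (\<Sum>j\<in>{j\<in>J B. j \<le> i}. ?t (B \<inter> {..i} - {d<..j}) * ?t (B \<inter> {d<..<j}))"
        proof (rule sum.cong)
          show "J (B \<inter> {..i}) = {j\<in>J B. j \<le> i}" by (auto simp: J_def)
          fix j assume "j \<in> {j\<in>J B. j \<le> i}"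
          then have "B \<inter> {..i} \<inter> {d<..<j} = B \<inter> {d<..<j}" by auto
          then show "?t (B \<inter> {..i} - {d<..j}) * ?t (B \<inter> {..i} \<inter> {d<..<j}) =
              ?t (B \<inter> {..i} - {d<..j}) * ?t (B \<inter> {d<..<j})" by simp
        qed
        finally show "?t (B \<inter> {..i}) * ?t (B \<inter> {i<..}) =
            (\<Sum>j\<in>{j\<in>J B. j \<le> i}. ?t (B \<inter> {..i} - {d<..j}) * ?t (B \<inter> {d<..<j}) * ?t (B \<inter> {i<..}))"
          by (simp add: sum_distrib_right)
      qed
      also have "\<dots> = (\<Sum>j\<in>J B. \<Sum>i\<in>{i\<in>K. j \<le> i}. ?t (B \<inter> {..i} - {d<..j}) * ?t (B \<inter> {d<..<j}) * ?t (B \<inter> {i<..}))"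
        by (rule sum.swap_restrict) (use fin in auto)
      finally show ?thesis by (simp only: sum_distrib_right sum_distrib_left mult_ac)
    qed
    also have "(\<Sum>j\<in>J B. (\<Sum>i\<in>I. ?t (B \<inter> {..i}) * ?t (B \<inter> {i<..} - {d<..j})) * ?t (B \<inter> {d<..<j})) +
        (?t (B \<inter> {..d}) * ?t (B \<inter> {d<..}) +
        (\<Sum>j\<in>J B. (\<Sum>i\<in>{i\<in>K. j \<le> i}. ?t (B \<inter> {..i} - {d<..j}) * ?t (B \<inter> {i<..})) * ?t (B \<inter> {d<..<j}))) =
        ?t (B \<inter> {..d}) * ?t (B \<inter> {d<..}) + (\<Sum>j\<in>J B. ((\<Sum>i\<in>I. ?t (B \<inter> {..i}) * ?t (B \<inter> {i<..} - {d<..j})) +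
          (\<Sum>i\<in>{i\<in>K. j \<le> i}. ?t (B \<inter> {..i} - {d<..j}) * ?t (B \<inter> {i<..}))) * ?t (B \<inter> {d<..<j}))"
      by (simp only: sum.distrib distrib_right add_ac)
    also have "(\<Sum>j\<in>J B. ((\<Sum>i\<in>I. ?t (B \<inter> {..i}) * ?t (B \<inter> {i<..} - {d<..j})) +
          (\<Sum>i\<in>{i\<in>K. j \<le> i}. ?t (B \<inter> {..i} - {d<..j}) * ?t (B \<inter> {i<..}))) * ?t (B \<inter> {d<..<j})) =
        (\<Sum>j\<in>J B. ?t (A - {d<..j}) * ?t (A \<inter> {d<..<j}))"
    \<comment> \<open>For fixed \<open>j\<close>, the cuts left over from \<open>B\<close> are
      compared with the root removal of \<open>A - {d<..j}\<close>, whose last position is still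
      \<open>m\<close>.\<close>
    proof (rule sum.cong[OF refl])
      fix j assume "j \<in> J B"
      then have j: "j \<in> B" "d < j" "\<pi> d < \<pi> j" by (auto simp: J_def)
      define C where "C = B - {d<..j}"
      have "A - {d<..j} = insert m C" using A B[OF j(1)] j by (auto simp: C_def)
      moreover have "A \<inter> {d<..<j} = B \<inter> {d<..<j}" using A B[OF j(1)] j by auto
      moreover have "?t (insert m C) = (\<Sum>i\<in>insert 0 C. ?t (C \<inter> {..i}) * ?t (C \<inter> {i<..}))"
        using dB by (intro rec) (auto simp: C_def)
      moreover have "insert 0 C = I \<union> ({d} \<union> {i\<in>K. j < i})"
        using dB d0 j by (auto simp: I_def K_def C_def)
      moreover have "(\<Sum>i\<in>I \<union> ({d} \<union> {i\<in>K. j < i}). ?t (C \<inter> {..i}) * ?t (C \<inter> {i<..})) =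
          (\<Sum>i\<in>I. ?t (C \<inter> {..i}) * ?t (C \<inter> {i<..})) + (?t (C \<inter> {..d}) * ?t (C \<inter> {d<..}) +
          (\<Sum>i\<in>{i\<in>K. j < i}. ?t (C \<inter> {..i}) * ?t (C \<inter> {i<..})))"
      proof -
        have "finite {i\<in>K. j < i}" "d \<notin> {i\<in>K. j < i}" "I \<inter> ({d} \<union> {i\<in>K. j < i}) = {}"
          using finB by (auto simp: I_def K_def)
        then show ?thesis using fin by (simp add: sum.union_disjoint)
      qed
      moreover have "(\<Sum>i\<in>I. ?t (C \<inter> {..i}) * ?t (C \<inter> {i<..})) =
          (\<Sum>i\<in>I. ?t (B \<inter> {..i}) * ?t (B \<inter> {i<..} - {d<..j}))"
      proof (rule sum.cong[OF refl])
        fix i assume "i \<in> I"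
        then have "C \<inter> {..i} = B \<inter> {..i}" "C \<inter> {i<..} = B \<inter> {i<..} - {d<..j}"
          by (auto simp: I_def C_def)
        then show "?t (C \<inter> {..i}) * ?t (C \<inter> {i<..}) = ?t (B \<inter> {..i}) * ?t (B \<inter> {i<..} - {d<..j})"
          by simp
      qed
      moreover have "(\<Sum>i\<in>{i\<in>K. j \<le> i}. ?t (B \<inter> {..i} - {d<..j}) * ?t (B \<inter> {i<..})) =
          ?t (C \<inter> {..d}) * ?t (C \<inter> {d<..}) + (\<Sum>i\<in>{i\<in>K. j < i}. ?t (C \<inter> {..i}) * ?t (C \<inter> {i<..}))"
      proof -
        \<comment> \<open>Contracting \<open>j\<close> to \<open>d\<close> turns the cut of
          \<open>B\<close> at \<open>j\<close> into the cut of \<open>C\<close> at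
          \<open>d\<close>.\<close>
        have "{i\<in>K. j \<le> i} = insert j {i\<in>K. j < i}" using j by (auto simp: K_def)
        then have "(\<Sum>i\<in>{i\<in>K. j \<le> i}. ?t (B \<inter> {..i} - {d<..j}) * ?t (B \<inter> {i<..})) =
            ?t (B \<inter> {..j} - {d<..j}) * ?t (B \<inter> {j<..}) +
            (\<Sum>i\<in>{i\<in>K. j < i}. ?t (B \<inter> {..i} - {d<..j}) * ?t (B \<inter> {i<..}))"
          using fin by simp
        also have "B \<inter> {..j} - {d<..j} = C \<inter> {..d}"
          using j by (auto simp: C_def)
        also have "B \<inter> {j<..} = C \<inter> {d<..}"
          using j by (auto simp: C_def)
        also have "(\<Sum>i\<in>{i\<in>K. j < i}. ?t (B \<inter> {..i} - {d<..j}) * ?t (B \<inter> {i<..})) =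
            (\<Sum>i\<in>{i\<in>K. j < i}. ?t (C \<inter> {..i}) * ?t (C \<inter> {i<..}))"
        proof (rule sum.cong[OF refl])
          fix i assume "i \<in> {i\<in>K. j < i}"
          then have "C \<inter> {..i} = B \<inter> {..i} - {d<..j}" "C \<inter> {i<..} = B \<inter> {i<..}"
            using j by (auto simp: C_def)
          then show "?t (B \<inter> {..i} - {d<..j}) * ?t (B \<inter> {i<..}) = ?t (C \<inter> {..i}) * ?t (C \<inter> {i<..})"
            by simp
        qed
        finally show ?thesis .
      qed
      ultimately show "((\<Sum>i\<in>I. ?t (B \<inter> {..i}) * ?t (B \<inter> {i<..} - {d<..j})) +
          (\<Sum>i\<in>{i\<in>K. j \<le> i}. ?t (B \<inter> {..i} - {d<..j}) * ?t (B \<inter> {i<..}))) * ?t (B \<inter> {d<..<j}) =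
          ?t (A - {d<..j}) * ?t (A \<inter> {d<..<j})"
        by simp
    qed
    \<comment> \<open>The cut at \<open>d\<close> supplies the one missing summand,
      \<open>j = m\<close>.\<close>
    also have "?t (B \<inter> {..d}) * ?t (B \<inter> {d<..}) + \<dots> =
        (\<Sum>j\<in>insert m (J B). ?t (A - {d<..j}) * ?t (A \<inter> {d<..<j}))"
    proof -
      have "A - {d<..m} = B \<inter> {..d}" "A \<inter> {d<..<m} = B \<inter> {d<..}"
        using A B dB by auto force+
      moreover have "m \<notin> J B" using A by (simp add: J_def)
      ultimately show ?thesis using fin by simp
    qed
    also have "insert m (J B) = J A"
      using A Bm[OF dB] B dB by (auto simp: J_def)
    finally show ?thesis by (simp add: J_def)
  qed
qed

section \<open>Hook configurations with one hook per descent\<close>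

definition descents_on :: "(nat \<Rightarrow> nat) \<Rightarrow> nat set \<Rightarrow> nat set"
  where "descents_on \<pi> A = {d\<in>A. \<exists>e\<in>A. d < e \<and> A \<inter> {d<..<e} = {} \<and> \<pi> e < \<pi> d}"

text \<open>
  A configuration keeps only the hooks whose southwest endpoint is a descent: in a valid hook
  configuration with \<open>w\<^sub>j \<in> {0, 2}\<close>, the other hooks are those joining \<open>j - 1\<close> to \<open>j\<close>,
  where \<open>j\<close> ranges over the northeast endpoints.
\<close>

definition configurations :: "(nat \<Rightarrow> nat) \<Rightarrow> nat set \<Rightarrow> hook set set"
  where "configurations \<pi> A = {H. fst ` H = descents_on \<pi> A \<and> snd ` H \<subseteq> A \<and>
    inj_on fst H \<and> inj_on snd H \<and>
    (\<forall>(i, j)\<in>H. i < j \<and> \<pi> i < \<pi> j) \<and>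
    (\<forall>(i, j)\<in>H. \<forall>(i', j')\<in>H. \<pi> j < \<pi> j' \<and> i < j' \<and> i' < j \<longrightarrow> i' \<le> i \<and> j \<le> j')}"

text \<open>Positions are counted from 1, so \<open>0\<close> can stand for the color \<open>c\<^sub>0\<close>.\<close>

definition innermost :: "hook set \<Rightarrow> nat \<Rightarrow> nat"
  where "innermost H k = Max (insert 0 {i. \<exists>j. (i, j) \<in> H \<and> i < k \<and> k < j})"

text \<open>Northeast endpoints are left out because each takes the color of the discarded hook from
  \<open>j - 1\<close> to \<open>j\<close>, and that color is not in \<open>Theta\<close>.\<close>

definition color_count :: "nat set \<Rightarrow> hook set \<Rightarrow> nat \<Rightarrow> nat"
  where "color_count A H c = card {k \<in> A - snd ` H. innermost H k = c}"

definition configuration_gf :: "(nat \<Rightarrow> nat) \<Rightarrow> nat set \<Rightarrow> real fps"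
  where "configuration_gf \<pi> A = (\<Sum>H\<in>configurations \<pi> A.
    \<Prod>c\<in>insert 0 (descents_on \<pi> A). unary_binary_gf (color_count A H c))"

text \<open>Take the last \<open>e\<close> in \<open>A\<close> from \<open>a\<close> on and before
  \<open>b\<close> whose value is at least \<open>\<pi> a\<close>. Its successor in \<open>A\<close>
  has a value below \<open>\<pi> a\<close>, so \<open>e\<close> is a descent.\<close>

lemma ex_descent_between:
  assumes "finite A" "a \<in> A" "b \<in> A" "a < b" "\<pi> b < \<pi> a"
  shows "\<exists>e\<in>descents_on \<pi> A. a \<le> e \<and> e < b \<and> \<pi> a \<le> \<pi> e"
proof -
  define e where "e = Max {x\<in>A \<inter> {a..<b}. \<pi> a \<le> \<pi> x}"
  have fin: "finite {x\<in>A \<inter> {a..<b}. \<pi> a \<le> \<pi> x}" using assms by simp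
  then have "e \<in> {x\<in>A \<inter> {a..<b}. \<pi> a \<le> \<pi> x}"
    unfolding e_def using assms by (intro Max_in) auto
  then have e: "e \<in> A" "a \<le> e" "e < b" "\<pi> a \<le> \<pi> e" by auto
  define f where "f = Min (A \<inter> {e<..b})"
  have "f \<in> A \<inter> {e<..b}" unfolding f_def using assms e by (intro Min_in) auto
  then have f: "f \<in> A" "e < f" "f \<le> b" by auto
  have "A \<inter> {e<..<f} = {}"
  proof (rule ccontr)
    assume "A \<inter> {e<..<f} \<noteq> {}"
    then obtain x where "x \<in> A" "e < x" "x < f" by auto
    moreover from this have "x \<in> A \<inter> {e<..b}" using f(3) by auto
    then have "f \<le> x" unfolding f_def using assms(1) by (intro Min_le) auto
    ultimately show False by simp
  qed
  moreover have "\<pi> f < \<pi> a"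
  proof (rule ccontr)
    assume *: "\<not> \<pi> f < \<pi> a"
    then have "f \<noteq> b" using assms by auto
    then have "f \<le> e" unfolding e_def using fin f e * by (intro Max_ge) (auto simp: e_def)
    then show False using f by simp
  qed
  ultimately show ?thesis using e f unfolding descents_on_def by force
qed

lemma configurationD:
  assumes "H \<in> configurations \<pi> A"
  shows "(i, j) \<in> H \<Longrightarrow> i \<in> descents_on \<pi> A" "(i, j) \<in> H \<Longrightarrow> i \<in> A" "(i, j) \<in> H \<Longrightarrow> j \<in> A"
    "(i, j) \<in> H \<Longrightarrow> i < j" "(i, j) \<in> H \<Longrightarrow> \<pi> i < \<pi> j"
    "(i, j) \<in> H \<Longrightarrow> (i, j') \<in> H \<Longrightarrow> j = j'" "(i, j) \<in> H \<Longrightarrow> (i', j) \<in> H \<Longrightarrow> i = i'"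
    "(i, j) \<in> H \<Longrightarrow> (i', j') \<in> H \<Longrightarrow> \<pi> j < \<pi> j' \<Longrightarrow> i < j' \<Longrightarrow> i' < j \<Longrightarrow> i' \<le> i \<and> j \<le> j'"
    "i \<in> descents_on \<pi> A \<Longrightarrow> \<exists>j. (i, j) \<in> H"
proof -
  have f: "fst ` H = descents_on \<pi> A" and s: "snd ` H \<subseteq> A"
    and inj: "inj_on fst H" "inj_on snd H"
    and up: "\<And>i j. (i, j) \<in> H \<Longrightarrow> i < j \<and> \<pi> i < \<pi> j"
    and nest: "\<And>i j i' j'. (i, j) \<in> H \<Longrightarrow> (i', j') \<in> H \<Longrightarrow> \<pi> j < \<pi> j' \<and> i < j' \<and> i' < j \<longrightarrow> i' \<le> i \<and> j \<le> j'"
    using assms unfolding configurations_def by auto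
  show 1: "(i, j) \<in> H \<Longrightarrow> i \<in> descents_on \<pi> A" using f by force
  then show "(i, j) \<in> H \<Longrightarrow> i \<in> A" by (simp add: descents_on_def)
  show "(i, j) \<in> H \<Longrightarrow> j \<in> A" using s by force
  show "(i, j) \<in> H \<Longrightarrow> i < j" "(i, j) \<in> H \<Longrightarrow> \<pi> i < \<pi> j" using up by blast+
  show "(i, j) \<in> H \<Longrightarrow> (i, j') \<in> H \<Longrightarrow> j = j'" "(i, j) \<in> H \<Longrightarrow> (i', j) \<in> H \<Longrightarrow> i = i'"
    using inj_onD[OF inj(1), of "(i, j)" "(i, j')"] inj_onD[OF inj(2), of "(i, j)" "(i', j)"] by simp_all
  show "(i, j) \<in> H \<Longrightarrow> (i', j') \<in> H \<Longrightarrow> \<pi> j < \<pi> j' \<Longrightarrow> i < j' \<Longrightarrow> i' < j \<Longrightarrow> i' \<le> i \<and> j \<le> j'"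
    using nest by blast
  show "i \<in> descents_on \<pi> A \<Longrightarrow> \<exists>j. (i, j) \<in> H" using f by force
qed

lemma configurationI:
  assumes "\<And>i j. (i, j) \<in> H \<Longrightarrow> i \<in> descents_on \<pi> A \<and> j \<in> A \<and> i < j \<and> \<pi> i < \<pi> j"
    and "\<And>i. i \<in> descents_on \<pi> A \<Longrightarrow> \<exists>j. (i, j) \<in> H"
    and "\<And>i j j'. (i, j) \<in> H \<Longrightarrow> (i, j') \<in> H \<Longrightarrow> j = j'"
    and "\<And>i i' j. (i, j) \<in> H \<Longrightarrow> (i', j) \<in> H \<Longrightarrow> i = i'"
    and "\<And>i j i' j'. (i, j) \<in> H \<Longrightarrow> (i', j') \<in> H \<Longrightarrow> \<pi> j < \<pi> j' \<Longrightarrow> i < j' \<Longrightarrow> i' < j \<Longrightarrow> i' \<le> i \<and> j \<le> j'"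
  shows "H \<in> configurations \<pi> A"
proof -
  have "fst ` H = descents_on \<pi> A" using assms(1,2) by force
  moreover have "snd ` H \<subseteq> A" using assms(1) by force
  moreover have "inj_on fst H" "inj_on snd H" using assms(3,4) by (auto intro!: inj_onI)
  moreover have "\<forall>(i, j)\<in>H. i < j \<and> \<pi> i < \<pi> j" using assms(1) by auto
  moreover have "\<forall>(i, j)\<in>H. \<forall>(i', j')\<in>H. \<pi> j < \<pi> j' \<and> i < j' \<and> i' < j \<longrightarrow> i' \<le> i \<and> j \<le> j'"
    using assms(5) by blast
  ultimately show ?thesis unfolding configurations_def by blast
qed

lemma innermost_in:
  assumes "H \<in> configurations \<pi> A"
  shows "innermost H k \<in> insert 0 (descents_on \<pi> A)"
proof -
  let ?I = "{i. \<exists>j. (i, j) \<in> H \<and> i < k \<and> k < j}"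
  have "finite ?I" by (rule finite_subset[of _ "{..<k}"]) auto
  then have "innermost H k \<in> insert 0 ?I" unfolding innermost_def by (intro Max_in) auto
  then show ?thesis using configurationD(1)[OF assms] by auto
qed

lemma finite_configurations: "finite A \<Longrightarrow> finite (configurations \<pi> A)"
proof (rule finite_subset)
  show "configurations \<pi> A \<subseteq> Pow (A \<times> A)" by (auto dest: configurationD(2,3))
qed simp

text \<open>A point \<open>y\<close> above the hook would force a descent \<open>e\<close> between
  \<open>y\<close> and \<open>j\<close> that is higher than \<open>j\<close>. The hook at
  \<open>e\<close> ends higher still, and nesting with the hook from \<open>i\<close> to
  \<open>j\<close> would push \<open>e\<close> back to \<open>i\<close> or further left.\<close>

lemma below_hook:
  assumes H: "H \<in> configurations \<pi> A" and fin: "finite A" and "inj_on \<pi> A"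
    and ij: "(i, j) \<in> H" and y: "y \<in> A" "i < y" "y < j"
  shows "\<pi> y < \<pi> j"
proof (rule ccontr)
  assume "\<not> \<pi> y < \<pi> j"
  moreover have "\<pi> y \<noteq> \<pi> j"
    using assms(3) y configurationD(3)[OF H ij] by (auto dest: inj_onD)
  ultimately have "\<pi> j < \<pi> y" by simp
  then obtain e where e: "e \<in> descents_on \<pi> A" "y \<le> e" "e < j" "\<pi> y \<le> \<pi> e"
    using ex_descent_between[OF fin y(1) configurationD(3)[OF H ij] y(3)] by blast
  then obtain f where f: "(e, f) \<in> H" using configurationD(9)[OF H] by blast
  have "e \<le> i"
    using configurationD(8)[OF H ij f] configurationD(4,5)[OF H f] \<open>\<pi> j < \<pi> y\<close> e y by simp
  then show False using e y by simp
qed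

lemma configurations_no_descents:
  assumes "descents_on \<pi> A = {}"
  shows "configurations \<pi> A = {{}}"
proof -
  have "H \<in> configurations \<pi> A \<longleftrightarrow> H = {}" for H
    using assms configurationD(1)[of H \<pi> A] by (auto intro: configurationI)
  then show ?thesis by blast
qed

lemma strict_mono_on_no_descents:
  assumes "descents_on \<pi> A = {}" "finite A" "inj_on \<pi> A"
  shows "strict_mono_on A \<pi>"
proof (rule strict_mono_onI)
  fix a b assume ab: "a \<in> A" "b \<in> A" "a < b"
  have "\<not> \<pi> b < \<pi> a" using ex_descent_between[OF assms(2) ab(1,2,3), of \<pi>] assms(1) by blast
  moreover have "\<pi> a \<noteq> \<pi> b" using ab assms(3) by (auto dest: inj_onD)
  ultimately show "\<pi> a < \<pi> b" by simp
qed

lemma configuration_gf_no_descents: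
  assumes "descents_on \<pi> A = {}"
  shows "configuration_gf \<pi> A = unary_binary_gf (card A)"
  unfolding configuration_gf_def configurations_no_descents[OF assms] assms
  by (simp add: color_count_def innermost_def)

section \<open>Cutting a configuration at the descent of largest value\<close>

locale max_descent =
  fixes \<pi> :: "nat \<Rightarrow> nat" and A :: "nat set" and d :: nat
  assumes finA: "finite A" and A0: "0 \<notin> A" and inj: "inj_on \<pi> A"
    and d: "d \<in> descents_on \<pi> A"
    and max: "\<And>e. e \<in> descents_on \<pi> A \<Longrightarrow> \<pi> e \<le> \<pi> d"
begin

lemma dA: "d \<in> A" using d by (simp add: descents_on_def)

lemma d_pos: "0 < d" using dA A0 by (cases d) auto

lemma inversion_le: "a \<in> A \<Longrightarrow> b \<in> A \<Longrightarrow> a < b \<Longrightarrow> \<pi> b < \<pi> a \<Longrightarrow> \<pi> a \<le> \<pi> d"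
  using ex_descent_between[OF finA, of a b \<pi>] max by force

definition "right_above = {j. j \<in> A \<and> d < j \<and> \<pi> d < \<pi> j}"
text \<open>The position \<open>j\<close> lies in neither part: as a tree node it is contracted to
  \<open>d\<close>, which stays unsheltered, and as a northeast endpoint it is not counted for any
  color.\<close>

definition "unsheltered j = A - {d<..j}"
definition "sheltered j = A \<inter> {d<..<j}"

text \<open>An exception would be an inversion with top above \<open>\<pi> d\<close>. Consequently a
  hook that ends right of \<open>j\<close> runs higher than the hook from \<open>d\<close> to
  \<open>j\<close>.\<close>

lemma above_increasing:
  assumes "j \<in> right_above" "x \<in> A" "j < x"
  shows "\<pi> j < \<pi> x"
proof -
  have "\<not> \<pi> x < \<pi> j" using inversion_le[of j x] assms by (auto simp: right_above_def)
  moreover have "\<pi> j \<noteq> \<pi> x" using inj assms by (auto simp: right_above_def dest: inj_onD)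
  ultimately show ?thesis by simp
qed

lemma sheltered_below:
  assumes "j \<in> right_above" "x \<in> sheltered j"
  shows "\<pi> x < \<pi> j"
proof -
  have "\<pi> x \<noteq> \<pi> j" using inj assms by (auto simp: right_above_def sheltered_def dest: inj_onD)
  moreover have "\<not> \<pi> j < \<pi> x"
    using inversion_le[of x j] assms by (auto simp: right_above_def sheltered_def)
  ultimately show ?thesis by simp
qed

lemma descents_on_sheltered:
  assumes j: "j \<in> right_above"
  shows "descents_on \<pi> (sheltered j) = descents_on \<pi> A \<inter> {d<..<j}"
proof (intro set_eqI iffI)
  fix x assume "x \<in> descents_on \<pi> (sheltered j)"
  then obtain e where "x \<in> A" "e \<in> A" "d < x" "x < j" "e < j" "x < e" "\<pi> e < \<pi> x"
    "sheltered j \<inter> {x<..<e} = {}"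
    by (auto simp: descents_on_def sheltered_def)
  moreover from this have "A \<inter> {x<..<e} = {}" by (auto simp: sheltered_def)
  ultimately show "x \<in> descents_on \<pi> A \<inter> {d<..<j}" unfolding descents_on_def by auto
next
  fix x assume x: "x \<in> descents_on \<pi> A \<inter> {d<..<j}"
  then obtain e where e: "x \<in> A" "e \<in> A" "d < x" "x < j" "x < e" "\<pi> e < \<pi> x" "A \<inter> {x<..<e} = {}"
    by (auto simp: descents_on_def)
  have jA: "j \<in> A" "\<pi> d < \<pi> j" using j by (auto simp: right_above_def)
  have "e \<le> j" using e jA by (meson disjoint_iff greaterThanLessThan_iff not_le_imp_less)
  \<comment> \<open>Dropping \<open>j\<close> loses no descent: a descent directly before
    \<open>j\<close> would be higher than \<open>j\<close>, hence higher than
    \<open>d\<close>.\<close>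
  moreover have "e \<noteq> j" using max[of x] x e jA by auto
  ultimately have "e \<in> sheltered j" "x \<in> sheltered j" using e by (auto simp: sheltered_def)
  moreover have "sheltered j \<inter> {x<..<e} = {}" using e by (auto simp: sheltered_def)
  ultimately show "x \<in> descents_on \<pi> (sheltered j)" unfolding descents_on_def using e by auto
qed

text \<open>The position \<open>d\<close> stays but stops being a descent, because everything to the
  right of the gap is higher than \<open>j\<close>.\<close>

lemma descents_on_unsheltered:
  assumes j: "j \<in> right_above"
  shows "descents_on \<pi> (unsheltered j) = descents_on \<pi> A - {d..j}"
proof (intro set_eqI iffI)
  have jA: "j \<in> A" "d < j" "\<pi> d < \<pi> j" using j by (auto simp: right_above_def)
  fix x assume "x \<in> descents_on \<pi> (unsheltered j)"
  then obtain e where e: "x \<in> A" "e \<in> A" "x \<le> d \<or> j < x" "e \<le> d \<or> j < e" "x < e" "\<pi> e < \<pi> x"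
    "unsheltered j \<inter> {x<..<e} = {}"
    by (auto simp: descents_on_def unsheltered_def not_less)
  have "x \<noteq> d"
  proof
    assume "x = d"
    then have "\<pi> j < \<pi> e" using e above_increasing[OF j, of e] by auto
    then show False using \<open>x = d\<close> e jA by simp
  qed
  moreover have "A \<inter> {x<..<e} = {}"
  proof (cases "x < d")
    case True
    then have "e \<le> d" using e(7) dA jA by (force simp: unsheltered_def)
    then show ?thesis using e(7) by (auto simp: unsheltered_def)
  next
    case False
    then show ?thesis using e \<open>x \<noteq> d\<close> by (auto simp: unsheltered_def)
  qed
  ultimately show "x \<in> descents_on \<pi> A - {d..j}" unfolding descents_on_def using e by auto
next
  have jA: "j \<in> A" "d < j" "\<pi> d < \<pi> j" using j by (auto simp: right_above_def)
  fix x assume "x \<in> descents_on \<pi> A - {d..j}"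
  then obtain e where e: "x \<in> A" "e \<in> A" "x < d \<or> j < x" "x < e" "\<pi> e < \<pi> x" "A \<inter> {x<..<e} = {}"
    by (auto simp: descents_on_def)
  have "e \<le> d \<or> j < e" using e dA jA
    by (metis disjoint_iff greaterThanLessThan_iff less_trans not_le_imp_less)
  then show "x \<in> descents_on \<pi> (unsheltered j)"
    unfolding descents_on_def unsheltered_def using e jA by auto
qed

lemma descents_on_split:
  assumes "j \<in> right_above"
  shows "descents_on \<pi> A =
    insert d (descents_on \<pi> (unsheltered j) \<union> descents_on \<pi> (sheltered j))"
proof -
  have "j \<notin> descents_on \<pi> A" using max[of j] assms by (auto simp: right_above_def)
  then show ?thesis
    unfolding descents_on_sheltered[OF assms] descents_on_unsheltered[OF assms]
    using d assms by (auto simp: right_above_def not_le less_le)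
qed

definition "join j H1 H2 = insert (d, j) (H1 \<union> H2)"

lemma finite_parts: "finite (unsheltered j)" "finite (sheltered j)" "inj_on \<pi> (unsheltered j)" "inj_on \<pi> (sheltered j)"
  using finA inj by (auto simp: unsheltered_def sheltered_def intro: inj_on_subset)

text \<open>Such a hook has its endpoints on different sides of the gap, and it cannot start at
  \<open>d\<close>, which is no descent of the unsheltered part. Ending right of \<open>j\<close>,
  it runs above the hook from \<open>d\<close> to \<open>j\<close>.\<close>

lemma hooks_over_sheltered:
  assumes j: "j \<in> right_above" and H1: "H1 \<in> configurations \<pi> (unsheltered j)"
    and ij: "(i', j') \<in> H1" "i' < j" "d < j'"
  shows "i' < d" "j < j'" "\<pi> j < \<pi> j'"
proof -
  have jA: "j \<in> A" "d < j" "\<pi> d < \<pi> j" using j by (auto simp: right_above_def)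
  show "i' < d"
    using configurationD(1)[OF H1 ij(1)] ij unfolding descents_on_unsheltered[OF j] by auto
  have j': "j' \<in> unsheltered j" using configurationD(3)[OF H1 ij(1)] .
  then show "j < j'" using ij by (auto simp: unsheltered_def)
  then show "\<pi> j < \<pi> j'" using above_increasing[OF j] j' by (auto simp: unsheltered_def)
qed

text \<open>Nesting needs an argument only for hooks of different origin. A hook of
  \<open>H1\<close> that overlaps the gap spans it and runs above the hook from \<open>d\<close> to
  \<open>j\<close>, which in turn spans and runs above all hooks of \<open>H2\<close>.\<close>

lemma join_configuration:
  assumes j: "j \<in> right_above"
    and H1: "H1 \<in> configurations \<pi> (unsheltered j)" and H2: "H2 \<in> configurations \<pi> (sheltered j)"
  shows "join j H1 H2 \<in> configurations \<pi> A"
proof (rule configurationI)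
  have jA: "j \<in> A" "d < j" "\<pi> d < \<pi> j" using j by (auto simp: right_above_def)
  note D1 = configurationD[OF H1] and D2 = configurationD[OF H2]
  note desc = descents_on_split[OF j]
  have U: "x \<in> A \<and> (x \<le> d \<or> j < x)" if "x \<in> unsheltered j" for x
    using that by (auto simp: unsheltered_def)
  have S: "x \<in> A \<and> d < x \<and> x < j" if "x \<in> sheltered j" for x
    using that by (auto simp: sheltered_def)
  have d1: "i \<noteq> d" if "(i, k) \<in> H1" for i k
    using D1(1)[OF that] jA unfolding descents_on_unsheltered[OF j] by auto
  show "i \<in> descents_on \<pi> A \<and> k \<in> A \<and> i < k \<and> \<pi> i < \<pi> k" if "(i, k) \<in> join j H1 H2" for i k
    using that d jA D1(1,3,4,5)[of i k] D2(1,3,4,5)[of i k] U[of k] S[of k]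
    unfolding join_def desc by auto
  show "\<exists>k. (i, k) \<in> join j H1 H2" if "i \<in> descents_on \<pi> A" for i
    using that D1(9)[of i] D2(9)[of i] unfolding join_def desc by auto
  have elim: thesis if "(i, k) \<in> join j H1 H2" "i = d \<Longrightarrow> k = j \<Longrightarrow> thesis"
    "(i, k) \<in> H1 \<Longrightarrow> i < d \<or> j < i \<Longrightarrow> k \<le> d \<or> j < k \<Longrightarrow> thesis"
    "(i, k) \<in> H2 \<Longrightarrow> d < i \<Longrightarrow> i < k \<Longrightarrow> k < j \<Longrightarrow> thesis" for i k thesis
    using that(1) unfolding join_def
  proof (elim insertE UnE)
    assume "(i, k) \<in> H1"
    then show thesis using that(3) U[of i] U[of k] D1(2,3)[of i k] d1[of i k] by auto
  next
    assume "(i, k) \<in> H2"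
    then show thesis using that(4) S[of i] S[of k] D2(2,3,4)[of i k] by auto
  qed (use that in auto)
  show "k = k'" if "(i, k) \<in> join j H1 H2" "(i, k') \<in> join j H1 H2" for i k k'
    using that D1(6)[of i k k'] D2(6)[of i k k'] jA
    by (elim elim) auto
  show "i = i'" if "(i, k) \<in> join j H1 H2" "(i', k) \<in> join j H1 H2" for i i' k
    using that D1(7)[of i k i'] D2(7)[of i k i'] jA
    by (elim elim) auto
  show "i' \<le> i \<and> k \<le> k'"
    if h: "(i, k) \<in> join j H1 H2" "(i', k') \<in> join j H1 H2" and k: "\<pi> k < \<pi> k'" "i < k'" "i' < k" for i k i' k'
  proof -
    have over: "a < d \<and> j < b \<and> \<pi> j < \<pi> b" if "(a, b) \<in> H1" "a < j" "d < b" for a b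
      using hooks_over_sheltered[OF j H1 that] by simp
    have under: "\<pi> b < \<pi> j" if "(a, b) \<in> H2" for a b
      using sheltered_below[OF j D2(3)[OF that]] .
    show ?thesis using h(1)
    proof (rule elim)
      assume 1: "i = d" "k = j"
      show ?thesis using h(2)
      proof (rule elim)
        assume "(i', k') \<in> H1"
        then show ?thesis using over[of i' k'] 1 k by auto
      next
        assume "(i', k') \<in> H2"
        then show ?thesis using under[of i' k'] 1 k by auto
      qed (use 1 k in auto)
    next
      assume 1: "(i, k) \<in> H1" "i < d \<or> j < i" "k \<le> d \<or> j < k"
      show ?thesis using h(2)
      proof (rule elim)
        assume "i' = d" "k' = j"
        then show ?thesis using over[of i k] 1 k by auto
      next
        assume "(i', k') \<in> H1"
        then show ?thesis using D1(8)[OF 1(1)] k by blast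
      next
        assume 2: "(i', k') \<in> H2" "d < i'" "i' < k'" "k' < j"
        then have "i < j" "d < k" using k by auto
        then show ?thesis using over[OF 1(1)] under[OF 2(1)] k by auto
      qed
    next
      assume 1: "(i, k) \<in> H2" "d < i" "i < k" "k < j"
      show ?thesis using h(2)
      proof (rule elim)
        assume 2: "(i', k') \<in> H1"
        have "i' < j" "d < k'" using 1 k by auto
        then show ?thesis using over[OF 2] 1 by auto
      next
        assume "(i', k') \<in> H2"
        then show ?thesis using D2(8)[OF 1(1)] k by blast
      qed (use 1 in auto)
    qed
  qed
qed

text \<open>Apart from the hook at \<open>d\<close>, no hook crosses the border of the sheltered
  part. One that starts inside and leaves would end higher than \<open>j\<close>, and nesting would
  make it start at or before \<open>d\<close>. One that enters from the left would end lower than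
  \<open>j\<close> by \<open>below_hook\<close>, and nesting would make it start at or after
  \<open>d\<close>.\<close>

lemma configuration_restrict:
  assumes H: "H \<in> configurations \<pi> A" and dj: "(d, j) \<in> H"
  shows "j \<in> right_above"
    and "H = join j (H \<inter> unsheltered j \<times> unsheltered j) (H \<inter> sheltered j \<times> sheltered j)"
    and "H \<inter> unsheltered j \<times> unsheltered j \<in> configurations \<pi> (unsheltered j)"
    and "H \<inter> sheltered j \<times> sheltered j \<in> configurations \<pi> (sheltered j)"
proof -
  note D = configurationD[OF H]
  show j: "j \<in> right_above" using D(3,4,5)[OF dj] by (simp add: right_above_def)
  have jA: "j \<in> A" "d < j" "\<pi> d < \<pi> j" using j by (auto simp: right_above_def)
  note desc = descents_on_split[OF j] descents_on_unsheltered[OF j] descents_on_sheltered[OF j]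
  let ?U = "unsheltered j" and ?S = "sheltered j"
  have inside: "(i, k) \<in> H \<inter> ?S \<times> ?S" if "(i, k) \<in> H" "d < i" "i \<le> j" for i k
  proof -
    have "i \<noteq> j" using max[of j] D(1)[OF that(1)] jA by auto
    then have "i < j" using that by simp
    moreover have "k < j"
    proof (rule ccontr)
      assume "\<not> k < j"
      moreover have "k \<noteq> j" using D(7)[OF dj, of i] that by auto
      ultimately have "j < k" by simp
      then have "\<pi> j < \<pi> k" using above_increasing[OF j] D(3)[OF that(1)] by blast
      then show False using D(8)[OF dj that(1)] \<open>j < k\<close> \<open>i < j\<close> jA that by auto
    qed
    ultimately show ?thesis using that D(2,3,4)[OF that(1)] by (auto simp: sheltered_def)
  qed
  have outside: "(i, k) \<in> H \<inter> ?U \<times> ?U" if "(i, k) \<in> H" "i < d \<or> j < i" for i k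
  proof -
    have "k \<le> d \<or> j < k"
    proof (rule ccontr)
      assume *: "\<not> (k \<le> d \<or> j < k)"
      moreover have "k \<noteq> j" using D(7)[OF dj, of i] that jA by auto
      ultimately have k: "d < k" "k < j" "i < d" using that D(4)[OF that(1)] by auto
      then have "\<pi> k < \<pi> j" using below_hook[OF H finA inj dj D(3)[OF that(1)]] by simp
      then show False using D(8)[OF that(1) dj] k by auto
    qed
    then show ?thesis using that D(2,3)[OF that(1)] jA by (auto simp: unsheltered_def)
  qed
  have d_out: "(i, k) \<in> H \<Longrightarrow> i \<noteq> d \<or> k = j" for i k using D(6)[OF dj] by auto
  show "H = join j (H \<inter> ?U \<times> ?U) (H \<inter> ?S \<times> ?S)"
  proof (intro set_eqI iffI)
    fix h assume "h \<in> H"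
    then obtain i k where "h = (i, k)" "(i, k) \<in> H" by (cases h) auto
    then show "h \<in> join j (H \<inter> ?U \<times> ?U) (H \<inter> ?S \<times> ?S)"
      using inside[of i k] outside[of i k] d_out[of i k] unfolding join_def
      by (cases i d rule: linorder_cases; cases "i \<le> j") auto
  qed (use dj in \<open>auto simp: join_def\<close>)
  show "H \<inter> ?U \<times> ?U \<in> configurations \<pi> ?U"
  proof (rule configurationI)
    fix i k assume ik: "(i, k) \<in> H \<inter> ?U \<times> ?U"
    have "i \<noteq> d" using ik d_out[of i k] jA by (auto simp: unsheltered_def)
    then have "i \<in> descents_on \<pi> ?U" using ik D(1)[of i k] unfolding desc(2) by (auto simp: unsheltered_def)
    then show "i \<in> descents_on \<pi> ?U \<and> k \<in> ?U \<and> i < k \<and> \<pi> i < \<pi> k"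
      using ik D(4,5)[of i k] by auto
  next
    fix i assume i: "i \<in> descents_on \<pi> ?U"
    then have "i \<in> descents_on \<pi> A" "i < d \<or> j < i" unfolding desc(2) by auto
    then show "\<exists>k. (i, k) \<in> H \<inter> ?U \<times> ?U" using D(9)[of i] outside by blast
  qed (use D(6,7,8) in blast)+
  show "H \<inter> ?S \<times> ?S \<in> configurations \<pi> ?S"
  proof (rule configurationI)
    fix i k assume ik: "(i, k) \<in> H \<inter> ?S \<times> ?S"
    then have "i \<in> descents_on \<pi> ?S" using D(1)[of i k] unfolding desc(3) by (auto simp: sheltered_def)
    then show "i \<in> descents_on \<pi> ?S \<and> k \<in> ?S \<and> i < k \<and> \<pi> i < \<pi> k"
      using ik D(4,5)[of i k] by auto
  next
    fix i assume i: "i \<in> descents_on \<pi> ?S"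
    then have "i \<in> descents_on \<pi> A" "d < i" "i \<le> j" unfolding desc(3) by auto
    then show "\<exists>k. (i, k) \<in> H \<inter> ?S \<times> ?S" using D(9)[of i] inside by blast
  qed (use D(6,7,8) in blast)+
qed

lemma join_inverse:
  assumes j: "j \<in> right_above"
    and H1: "H1 \<in> configurations \<pi> (unsheltered j)" and H2: "H2 \<in> configurations \<pi> (sheltered j)"
  shows "join j H1 H2 \<inter> unsheltered j \<times> unsheltered j = H1"
    and "join j H1 H2 \<inter> sheltered j \<times> sheltered j = H2"
proof -
  have "d < j" using j by (simp add: right_above_def)
  then have disj: "unsheltered j \<inter> sheltered j = {}" "j \<notin> unsheltered j" "j \<notin> sheltered j"
    by (auto simp: unsheltered_def sheltered_def)
  have 1: "H1 \<subseteq> unsheltered j \<times> unsheltered j" using configurationD(2,3)[OF H1] by auto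
  have 2: "H2 \<subseteq> sheltered j \<times> sheltered j" using configurationD(2,3)[OF H2] by auto
  show "join j H1 H2 \<inter> unsheltered j \<times> unsheltered j = H1"
    "join j H1 H2 \<inter> sheltered j \<times> sheltered j = H2"
    unfolding join_def using disj 1 2 by blast+
qed

text \<open>Hooks of \<open>H1\<close> over a sheltered point start left of \<open>d\<close> and
  lose to the hook at \<open>d\<close>; hooks of \<open>H2\<close> start right of \<open>d\<close>
  and win. So the label \<open>0\<close> of the sheltered part turns into \<open>d\<close>.\<close>

lemma innermost_join:
  assumes j: "j \<in> right_above"
    and H1: "H1 \<in> configurations \<pi> (unsheltered j)" and H2: "H2 \<in> configurations \<pi> (sheltered j)"
  shows "k \<in> unsheltered j \<Longrightarrow> innermost (join j H1 H2) k = innermost H1 k"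
    and "k \<in> sheltered j \<Longrightarrow>
      innermost (join j H1 H2) k = (if innermost H2 k = 0 then d else innermost H2 k)"
proof -
  note D1 = configurationD[OF H1] and D2 = configurationD[OF H2]
  have jA: "j \<in> A" "d < j" "\<pi> d < \<pi> j" using j by (auto simp: right_above_def)
  let ?I = "\<lambda>H. {i. \<exists>j. (i, j) \<in> H \<and> i < k \<and> k < j}"
  have H2: "d < a \<and> a < b \<and> b < j" if "(a, b) \<in> H2" for a b
    using D2(2,3,4)[OF that] by (auto simp: sheltered_def)
  show "innermost (join j H1 H2) k = innermost H1 k" if "k \<in> unsheltered j"
  proof -
    have "k \<le> d \<or> j < k" using that by (auto simp: unsheltered_def)
    then have "?I (join j H1 H2) = ?I H1" unfolding join_def using H2 by fastforce
    then show ?thesis by (simp add: innermost_def)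
  qed
  assume "k \<in> sheltered j"
  then have k: "d < k" "k < j" by (auto simp: sheltered_def)
  have I_join: "?I (join j H1 H2) = ?I H2 \<union> insert d (?I H1)" unfolding join_def using k by auto
  have fin: "finite (?I H)" for H by (rule finite_subset[of _ "{..<k}"]) auto
  have Max_d: "Max (insert 0 (insert d (?I H1))) = d"
  proof (rule Max_eqI)
    fix a assume "a \<in> insert 0 (insert d (?I H1))"
    then show "a \<le> d"
      using hooks_over_sheltered(1)[OF j \<open>H1 \<in> _\<close>, of a] k by (force intro: less_imp_le)
  qed (use fin in auto)
  have "innermost (join j H1 H2) k = Max (insert 0 (?I H2) \<union> insert 0 (insert d (?I H1)))"
    unfolding innermost_def I_join by (rule arg_cong[of _ _ Max]) auto
  also have "\<dots> = max (Max (insert 0 (?I H2))) (Max (insert 0 (insert d (?I H1))))"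
    using fin by (intro Max_Un) auto
  also have "\<dots> = max (innermost H2 k) d" unfolding Max_d by (simp add: innermost_def)
  finally have eq: "innermost (join j H1 H2) k = max (innermost H2 k) d" .
  have "innermost H2 k = 0 \<or> d < innermost H2 k"
  proof -
    have "innermost H2 k \<in> insert 0 (?I H2)" unfolding innermost_def using fin by (intro Max_in) auto
    then show ?thesis using H2 by auto
  qed
  then show "innermost (join j H1 H2) k = (if innermost H2 k = 0 then d else innermost H2 k)"
    using eq by auto
qed

lemma color_count_join:
  assumes j: "j \<in> right_above"
    and H1: "H1 \<in> configurations \<pi> (unsheltered j)" and H2: "H2 \<in> configurations \<pi> (sheltered j)"
  shows "c \<in> insert 0 (descents_on \<pi> (unsheltered j)) \<Longrightarrow>
      color_count A (join j H1 H2) c = color_count (unsheltered j) H1 c"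
    and "c \<in> descents_on \<pi> (sheltered j) \<Longrightarrow>
      color_count A (join j H1 H2) c = color_count (sheltered j) H2 c"
    and "color_count A (join j H1 H2) d = color_count (sheltered j) H2 0"
proof -
  have jA: "j \<in> A" "d < j" "\<pi> d < \<pi> j" using j by (auto simp: right_above_def)
  let ?H = "join j H1 H2" and ?U = "unsheltered j" and ?S = "sheltered j"
  have ne1: "snd ` H1 \<subseteq> ?U" using configurationD(3)[OF H1] by force
  have ne2: "snd ` H2 \<subseteq> ?S" using configurationD(3)[OF H2] by force
  have disj: "?U \<inter> ?S = {}" by (auto simp: unsheltered_def sheltered_def)
  have A: "A - {j} = ?U \<union> ?S"
    unfolding unsheltered_def sheltered_def using jA by auto
  have "A - snd ` ?H = (A - {j}) - (snd ` H1 \<union> snd ` H2)" unfolding join_def by auto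
  also have "\<dots> = (?U - snd ` H1) \<union> (?S - snd ` H2)" unfolding A using ne1 ne2 disj by blast
  finally have split: "A - snd ` ?H = (?U - snd ` H1) \<union> (?S - snd ` H2)" .
  note inner = innermost_join[OF j H1 H2]
  have in1: "innermost H1 k \<in> insert 0 (descents_on \<pi> ?U)" for k using innermost_in[OF H1] .
  have in2: "innermost H2 k \<in> insert 0 (descents_on \<pi> ?S)" for k using innermost_in[OF H2] .
  have dU: "d \<notin> descents_on \<pi> ?U" "d \<notin> descents_on \<pi> ?S"
    "descents_on \<pi> ?U \<inter> descents_on \<pi> ?S = {}" "0 \<notin> descents_on \<pi> ?U" "0 \<notin> descents_on \<pi> ?S"
    unfolding descents_on_unsheltered[OF j] descents_on_sheltered[OF j]
    using jA d_pos A0 by (auto simp: descents_on_def)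
  show "color_count A ?H c = color_count ?U H1 c" if c: "c \<in> insert 0 (descents_on \<pi> ?U)"
  proof -
    have "innermost ?H k \<noteq> c" if "k \<in> ?S" for k
      using inner(2)[OF that] in2[of k] c dU d_pos by (auto split: if_splits)
    then have "{k \<in> A - snd ` ?H. innermost ?H k = c} = {k \<in> ?U - snd ` H1. innermost H1 k = c}"
      unfolding split(1) using inner(1) by auto
    then show ?thesis by (simp add: color_count_def)
  qed
  show "color_count A ?H c = color_count ?S H2 c" if c: "c \<in> descents_on \<pi> ?S"
  proof -
    have "innermost ?H k \<noteq> c" if "k \<in> ?U" for k
      using inner(1)[OF that] in1[of k] c dU by auto
    moreover have "innermost ?H k = c \<longleftrightarrow> innermost H2 k = c" if "k \<in> ?S" for k
      using inner(2)[OF that] c dU by auto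
    ultimately have "{k \<in> A - snd ` ?H. innermost ?H k = c} = {k \<in> ?S - snd ` H2. innermost H2 k = c}"
      unfolding split(1) by auto
    then show ?thesis by (simp add: color_count_def)
  qed
  show "color_count A ?H d = color_count ?S H2 0"
  proof -
    have "innermost ?H k \<noteq> d" if "k \<in> ?U" for k
      using inner(1)[OF that] in1[of k] dU d_pos by auto
    moreover have "innermost ?H k = d \<longleftrightarrow> innermost H2 k = 0" if "k \<in> ?S" for k
      using inner(2)[OF that] in2[of k] dU by auto
    ultimately have "{k \<in> A - snd ` ?H. innermost ?H k = d} = {k \<in> ?S - snd ` H2. innermost H2 k = 0}"
      unfolding split(1) by auto
    then show ?thesis by (simp add: color_count_def)
  qed
qed

lemma configuration_gf_rec:
  "configuration_gf \<pi> A =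
    (\<Sum>j\<in>right_above. configuration_gf \<pi> (unsheltered j) * configuration_gf \<pi> (sheltered j))"
proof -
  define W where "W B H = (\<Prod>c\<in>insert 0 (descents_on \<pi> B). unary_binary_gf (color_count B H c))" for B H
  have gf: "configuration_gf \<pi> B = (\<Sum>H\<in>configurations \<pi> B. W B H)" for B
    by (simp add: configuration_gf_def W_def)
  define T where "T = (SIGMA j:right_above. configurations \<pi> (unsheltered j) \<times> configurations \<pi> (sheltered j))"
  have fin: "finite right_above" using finA by (simp add: right_above_def)
  have W_join: "W A (join j H1 H2) = W (unsheltered j) H1 * W (sheltered j) H2"
    if j: "j \<in> right_above" and H: "H1 \<in> configurations \<pi> (unsheltered j)" "H2 \<in> configurations \<pi> (sheltered j)"
    for j H1 H2
  proof -
    let ?U = "descents_on \<pi> (unsheltered j)" and ?S = "descents_on \<pi> (sheltered j)"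
    have fin': "finite ?U" "finite ?S" using finite_parts by (auto simp: descents_on_def)
    have dj: "d < j" using j by (auto simp: right_above_def)
    have disj: "d \<notin> ?U" "d \<notin> ?S" "?U \<inter> ?S = {}" "0 \<notin> ?U" "0 \<notin> ?S"
      unfolding descents_on_unsheltered[OF j] descents_on_sheltered[OF j]
      using dj A0 by (auto simp: descents_on_def)
    let ?f = "\<lambda>c. unary_binary_gf (color_count A (join j H1 H2) c)"
    \<comment> \<open>The factor for \<open>d\<close> goes to the sheltered part, where it is the
      factor for \<open>0\<close>; the factor for \<open>0\<close> itself goes to the unsheltered
      part.\<close>
    have "W A (join j H1 H2) = (\<Prod>c\<in>insert 0 ?U \<union> insert d ?S. ?f c)"
      unfolding W_def descents_on_split[OF j] by (rule prod.cong) auto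
    also have "\<dots> = (\<Prod>c\<in>insert 0 ?U. ?f c) * (\<Prod>c\<in>insert d ?S. ?f c)"
      using fin' disj d_pos by (intro prod.union_disjoint) auto
    also have "(\<Prod>c\<in>insert 0 ?U. ?f c) = W (unsheltered j) H1"
      unfolding W_def by (rule prod.cong[OF refl]) (simp only: color_count_join(1)[OF j H])
    also have "(\<Prod>c\<in>insert d ?S. ?f c) = W (sheltered j) H2"
      unfolding W_def using fin' disj color_count_join(2,3)[OF j H] by simp
    finally show ?thesis .
  qed
  define top where "top H = (THE j. (d, j) \<in> H)" for H :: "hook set"
  have top_eq: "top H = j" if "H \<in> configurations \<pi> A" "(d, j) \<in> H" for H j
    unfolding top_def using that configurationD(6)[OF that(1)] by blast
  have "(\<Sum>H\<in>configurations \<pi> A. W A H) = (\<Sum>(j, H1, H2)\<in>T. W (unsheltered j) H1 * W (sheltered j) H2)"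
  proof (rule sum.reindex_bij_witness[of _ "\<lambda>(j, H1, H2). join j H1 H2"
        "\<lambda>H. (top H, H \<inter> unsheltered (top H) \<times> unsheltered (top H), H \<inter> sheltered (top H) \<times> sheltered (top H))"])
    fix H assume H: "H \<in> configurations \<pi> A"
    obtain j where j: "(d, j) \<in> H" using configurationD(9)[OF H d] by blast
    note r = configuration_restrict[OF H j] and t = top_eq[OF H j]
    show "(case (top H, H \<inter> unsheltered (top H) \<times> unsheltered (top H), H \<inter> sheltered (top H) \<times> sheltered (top H))
        of (j, H1, H2) \<Rightarrow> join j H1 H2) = H"
      using r(2) by (simp add: t)
    show "(top H, H \<inter> unsheltered (top H) \<times> unsheltered (top H), H \<inter> sheltered (top H) \<times> sheltered (top H)) \<in> T"
      using r(1,3,4) by (simp add: t T_def)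
    show "(case (top H, H \<inter> unsheltered (top H) \<times> unsheltered (top H), H \<inter> sheltered (top H) \<times> sheltered (top H))
        of (j, H1, H2) \<Rightarrow> W (unsheltered j) H1 * W (sheltered j) H2) = W A H"
      using W_join[OF r(1,3,4)] r(2) by (simp add: t)
  next
    fix x assume "x \<in> T"
    then obtain j H1 H2 where x: "x = (j, H1, H2)" "j \<in> right_above"
      "H1 \<in> configurations \<pi> (unsheltered j)" "H2 \<in> configurations \<pi> (sheltered j)"
      by (auto simp: T_def)
    have J: "join j H1 H2 \<in> configurations \<pi> A" using join_configuration x by blast
    have t: "top (join j H1 H2) = j" by (rule top_eq[OF J]) (simp add: join_def)
    show "(case x of (j, H1, H2) \<Rightarrow> join j H1 H2) \<in> configurations \<pi> A" using J x by simp
    show "(\<lambda>H. (top H, H \<inter> unsheltered (top H) \<times> unsheltered (top H), H \<inter> sheltered (top H) \<times> sheltered (top H)))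
        (case x of (j, H1, H2) \<Rightarrow> join j H1 H2) = x"
      using join_inverse[OF x(2,3,4)] x(1) by (simp add: t)
  qed
  also have "\<dots> = (\<Sum>j\<in>right_above. \<Sum>(H1, H2)\<in>configurations \<pi> (unsheltered j) \<times> configurations \<pi> (sheltered j).
      W (unsheltered j) H1 * W (sheltered j) H2)"
    unfolding T_def using fin finite_configurations finite_parts
    by (subst sum.Sigma) (auto intro!: sum.cong)
  also have "\<dots> = (\<Sum>j\<in>right_above. configuration_gf \<pi> (unsheltered j) * configuration_gf \<pi> (sheltered j))"
    by (simp add: gf sum_product sum.cartesian_product)
  finally show ?thesis by (simp add: gf)
qed

end

text \<open>Both series satisfy the same recursion at the descent of largest value, and they agree
  when there is no descent.\<close>

lemma tree_gf_eq_configuration_gf: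
  assumes "finite A" "A \<noteq> {}" "0 \<notin> A" "inj_on \<pi> A"
  shows "tree_gf \<pi> A = configuration_gf \<pi> A"
  using assms
proof (induction "card A" arbitrary: A rule: less_induct)
  case less
  show ?case
  proof (cases "descents_on \<pi> A = {}")
    case True
    then show ?thesis
      using less.prems by (simp add: configuration_gf_no_descents tree_gf_increasing strict_mono_on_no_descents)
  next
    case False
    have "finite (descents_on \<pi> A)" using less.prems(1) by (simp add: descents_on_def)
    then have "Max (\<pi> ` descents_on \<pi> A) \<in> \<pi> ` descents_on \<pi> A" using False by simp
    then obtain d where "d \<in> descents_on \<pi> A" "\<pi> d = Max (\<pi> ` descents_on \<pi> A)" by auto
    then have d: "d \<in> descents_on \<pi> A" "\<And>e. e \<in> descents_on \<pi> A \<Longrightarrow> \<pi> e \<le> \<pi> d"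
      using \<open>finite (descents_on \<pi> A)\<close> by auto
    interpret max_descent \<pi> A d using less.prems d by unfold_locales auto
    obtain e where e: "d \<in> A" "e \<in> A" "d < e" "A \<inter> {d<..<e} = {}" "\<pi> e < \<pi> d"
      using d(1) by (auto simp: descents_on_def)
    have "tree_gf \<pi> A = (\<Sum>j\<in>right_above. tree_gf \<pi> (unsheltered j) * tree_gf \<pi> (sheltered j))"
      unfolding right_above_def unsheltered_def sheltered_def
      using less.prems e inversion_le by (intro tree_gf_descent[of A \<pi> d e]) auto
    also have "\<dots> = (\<Sum>j\<in>right_above. configuration_gf \<pi> (unsheltered j) * configuration_gf \<pi> (sheltered j))"
    proof (rule sum.cong[OF refl])
      fix j assume j: "j \<in> right_above"
      then have jA: "j \<in> A" "d < j" "\<pi> d < \<pi> j" by (auto simp: right_above_def)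
      \<comment> \<open>Both parts must be nonempty, since at the empty set the two series differ.
        The successor \<open>e\<close> of \<open>d\<close> is lower than \<open>d\<close>, so it is
        not \<open>j\<close> and is sheltered.\<close>
      have "e \<le> j" using e(4) jA by (meson disjoint_iff greaterThanLessThan_iff not_le_imp_less)
      moreover have "e \<noteq> j" using e(5) jA by auto
      ultimately have "e \<in> sheltered j" using e by (simp add: sheltered_def)
      moreover have "d \<in> unsheltered j" using e by (simp add: unsheltered_def)
      moreover have "unsheltered j \<subset> A" "sheltered j \<subset> A"
        using jA e(1) by (auto simp: unsheltered_def sheltered_def)
      moreover from this have "card (unsheltered j) < card A" "card (sheltered j) < card A"
        using less.prems(1) by (auto intro: psubset_card_mono)
      ultimately have "tree_gf \<pi> (unsheltered j) = configuration_gf \<pi> (unsheltered j)"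
        "tree_gf \<pi> (sheltered j) = configuration_gf \<pi> (sheltered j)"
        using less.prems(3) finite_parts by (auto intro!: less.hyps)
      then show "tree_gf \<pi> (unsheltered j) * tree_gf \<pi> (sheltered j) =
          configuration_gf \<pi> (unsheltered j) * configuration_gf \<pi> (sheltered j)" by simp
    qed
    also have "\<dots> = configuration_gf \<pi> A" by (rule configuration_gf_rec[symmetric])
    finally show ?thesis .
  qed
qed

section \<open>Sums over compositions as coefficients of a product\<close>

lemma finite_compositions: "finite (compositions k p)"
proof (rule finite_subset)
  show "compositions k p \<subseteq> {js. set js \<subseteq> {..p} \<and> length js = k + 1}"
    by (auto simp: compositions_def dest: member_le_sum_list)
qed (simp add: finite_lists_length_eq)

text \<open>A coefficient of a product sums over all sequences of exponents with total
  \<open>p\<close>; the vanishing constant terms remove the sequences with an entry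
  \<open>0\<close>.\<close>

lemma sum_compositions:
  fixes F :: "nat \<Rightarrow> real fps"
  assumes F0: "\<And>t. fps_nth (F t) 0 = 0"
  shows "(\<Sum>js\<in>compositions k p. \<Prod>t = 0..k. fps_nth (F t) (js ! t)) = fps_nth (\<Prod>t = 0..k. F t) p"
proof (induction k arbitrary: p)
  case 0
  have "compositions 0 p = (if p = 0 then {} else {[p]})"
    by (auto simp: compositions_def length_Suc_conv)
  then show ?case using F0 by simp
next
  case (Suc k)
  have "(\<Sum>js\<in>compositions (Suc k) p. \<Prod>t = 0..Suc k. fps_nth (F t) (js ! t)) =
      (\<Sum>(i, js)\<in>(SIGMA i:{0..<p}. compositions k i). (\<Prod>t = 0..k. fps_nth (F t) (js ! t)) * fps_nth (F (Suc k)) (p - i))"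
  proof (rule sum.reindex_bij_witness[of _ "\<lambda>(i, js). js @ [p - i]" "\<lambda>js. (sum_list (butlast js), butlast js)"])
    fix js assume js: "js \<in> compositions (Suc k) p"
    then obtain ks x where ks: "js = ks @ [x]" by (cases js rule: rev_cases) (auto simp: compositions_def)
    have x: "0 < x" "length ks = Suc k" "sum_list ks + x = p" "\<forall>y\<in>set ks. 0 < y"
      using js by (auto simp: compositions_def ks)
    then show "(case (sum_list (butlast js), butlast js) of (i, js) \<Rightarrow> js @ [p - i]) = js"
      "(sum_list (butlast js), butlast js) \<in> (SIGMA i:{0..<p}. compositions k i)"
      by (auto simp: ks compositions_def)
    have "(\<Prod>t = 0..k. fps_nth (F t) (ks ! t)) = (\<Prod>t = 0..k. fps_nth (F t) (js ! t))"
      by (rule prod.cong) (simp_all add: ks nth_append x)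
    moreover have "js ! Suc k = x" "p - sum_list ks = x" using x by (auto simp: ks nth_append)
    ultimately show "(case (sum_list (butlast js), butlast js) of (i, js) \<Rightarrow>
        (\<Prod>t = 0..k. fps_nth (F t) (js ! t)) * fps_nth (F (Suc k)) (p - i)) =
        (\<Prod>t = 0..Suc k. fps_nth (F t) (js ! t))"
      by (simp add: ks)
  next
    fix x assume "x \<in> (SIGMA i:{0..<p}. compositions k i)"
    then show "(\<lambda>js. (sum_list (butlast js), butlast js)) (case x of (i, js) \<Rightarrow> js @ [p - i]) = x"
      "(case x of (i, js) \<Rightarrow> js @ [p - i]) \<in> compositions (Suc k) p"
      by (auto simp: compositions_def)
  qed
  also have "\<dots> = (\<Sum>i = 0..<p. (\<Sum>js\<in>compositions k i. \<Prod>t = 0..k. fps_nth (F t) (js ! t)) * fps_nth (F (Suc k)) (p - i))"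
    by (simp add: sum.Sigma[symmetric] finite_compositions sum_distrib_right)
  \<comment> \<open>The additional term \<open>i = p\<close> contains the constant coefficient of
    the last factor, which is \<open>0\<close>.\<close>
  also have "\<dots> = (\<Sum>i = 0..p. fps_nth (\<Prod>t = 0..k. F t) i * fps_nth (F (Suc k)) (p - i))"
    unfolding Suc.IH by (rule sum.mono_neutral_left) (auto simp: F0)
  also have "\<dots> = fps_nth (\<Prod>t = 0..Suc k. F t) p"
    by (simp add: fps_mult_nth)
  finally show ?case .
qed

section \<open>Valid hook configurations\<close>

text \<open>The order of the hooks is dictated by their southwest endpoints, so a valid hook
  configuration is determined by its set of hooks; this recovers the list.\<close>

definition hook_list :: "hook set \<Rightarrow> hook list"
  where "hook_list T = map (\<lambda>i. (i, THE j. (i, j) \<in> T)) (sorted_list_of_set (fst ` T))"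

lemma the_snd_eq:
  assumes "inj_on fst T" "h \<in> T"
  shows "(THE j. (fst h, j) \<in> T) = snd h"
proof (rule the_equality)
  fix j assume "(fst h, j) \<in> T"
  then have "(fst h, j) = h" using inj_onD[OF assms(1), of "(fst h, j)" h] assms(2) by simp
  then show "j = snd h" by (metis snd_conv)
qed (use assms in simp)

lemma hook_list_eq:
  assumes "sorted_wrt (<) (map fst H)"
  shows "hook_list (set H) = H"
proof -
  have fsts: "sorted_list_of_set (fst ` set H) = map fst H"
    using assms sorted_list_of_set.idem_if_sorted_distinct[of "map fst H"] by (simp add: strict_sorted_iff)
  have "inj_on fst (set H)" using assms by (simp add: strict_sorted_iff distinct_map)
  then have "(THE j. (fst h, j) \<in> set H) = snd h" if "h \<in> set H" for h
    using that by (rule the_snd_eq)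
  then show ?thesis unfolding hook_list_def fsts by (auto intro!: map_idI)
qed

lemma
  assumes "finite T" "inj_on fst T"
  shows set_hook_list: "set (hook_list T) = T"
    and sorted_hook_list: "sorted_wrt (<) (map fst (hook_list T))"
proof -
  have "(THE j. (fst h, j) \<in> T) = snd h" if "h \<in> T" for h
    using assms(2) that by (rule the_snd_eq)
  then show "set (hook_list T) = T" using assms(1) by (force simp: hook_list_def)
  have "map fst (hook_list T) = sorted_list_of_set (fst ` T)" by (simp add: hook_list_def comp_def)
  then show "sorted_wrt (<) (map fst (hook_list T))" by simp
qed

section \<open>Restoring the hooks that do not start at descents\<close>

locale distinct_word =
  fixes \<pi> :: "nat list"
  assumes dist: "distinct \<pi>"
begin

abbreviation val :: "nat \<Rightarrow> nat" where "val i \<equiv> \<pi> !\<^sub>1 i"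

abbreviation pos :: "nat set" where "pos \<equiv> {1..length \<pi>}"

lemma inj_val: "inj_on val pos"
  using dist by (auto simp: nth1_def inj_on_def nth_eq_iff_index_eq)

lemma word_val: "word val pos = \<pi>"
proof -
  have "sorted_list_of_set pos = [1..<Suc (length \<pi>)]"
    by (metis atLeastLessThanSuc_atLeastAtMost sorted_list_of_set_range)
  then show ?thesis by (auto simp: word_def nth1_def intro!: nth_equalityI simp del: upt_Suc)
qed

lemma descents_eq: "descents_on val pos = descents \<pi>"
proof (intro set_eqI iffI)
  fix d assume "d \<in> descents_on val pos"
  then obtain e where e: "d \<in> pos" "e \<in> pos" "d < e" "pos \<inter> {d<..<e} = {}" "val e < val d"
    by (auto simp: descents_on_def)
  have "e = d + 1"
  proof (rule ccontr)
    assume "e \<noteq> d + 1"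
    then have "d + 1 \<in> pos \<inter> {d<..<e}" using e(1,2,3) by auto
    then show False using e by blast
  qed
  then show "d \<in> descents \<pi>" using e by (simp add: descents_def)
next
  fix d assume d: "d \<in> descents \<pi>"
  then have "pos \<inter> {d<..<d + 1} = {}" "d + 1 \<in> pos" "d \<in> pos" by (auto simp: descents_def)
  then show "d \<in> descents_on val pos"
    using d unfolding descents_on_def by (auto simp: descents_def intro!: bexI[of _ "d + 1"])
qed

definition descent_hooks :: "hook list \<Rightarrow> hook set"
  where "descent_hooks H = {h\<in>set H. fst h \<in> descents \<pi>}"

text \<open>Condition (c) forces a hook from \<open>j - 1\<close> to \<open>j\<close> at every
  northeast endpoint \<open>j\<close>, so the discarded hooks can be put back.\<close>

definition all_hooks :: "hook set \<Rightarrow> hook set"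
  where "all_hooks C = C \<union> (\<lambda>j. (j - 1, j)) ` snd ` C"

lemma all_hooksI:
  assumes "(i, j) \<in> C"
  shows "(i, j) \<in> all_hooks C" "(j - 1, j) \<in> all_hooks C"
proof -
  have "j \<in> snd ` C" using assms by force
  then show "(i, j) \<in> all_hooks C" "(j - 1, j) \<in> all_hooks C"
    using assms unfolding all_hooks_def by blast+
qed

lemma hook_interval_overlap:
  assumes "i < j" "i' < j'"
  shows "(\<exists>x y. x \<noteq> y \<and> {x, y} \<subseteq> hook_interval (i, j) \<inter> hook_interval (i', j')) \<longleftrightarrow> i < j' \<and> i' < j"
    (is "?L \<longleftrightarrow> ?R")
proof
  assume ?L
  then obtain x y where xy: "x \<noteq> y" "real i \<le> x" "x \<le> real j" "real i \<le> y" "y \<le> real j"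
    "real i' \<le> x" "x \<le> real j'" "real i' \<le> y" "y \<le> real j'"
    by (auto simp: hook_interval_def)
  then have "real i < real j'" "real i' < real j" by linarith+
  then show ?R by simp
next
  assume ?R
  let ?x = "real (max i i')" and ?y = "real (min j j')"
  have "?x \<noteq> ?y" using assms \<open>?R\<close> by (simp add: max_def min_def)
  moreover have "{?x, ?y} \<subseteq> hook_interval (i, j) \<inter> hook_interval (i', j')"
    using assms \<open>?R\<close> by (auto simp: hook_interval_def)
  ultimately show ?L by blast
qed

lemma hook_interval_subset:
  "i < j \<Longrightarrow> hook_interval (i, j) \<subseteq> hook_interval (i', j') \<longleftrightarrow> i' \<le> i \<and> j \<le> j'"
  by (auto simp: hook_interval_def)

lemma ne_count_eq:
  assumes "distinct H"
  shows "ne_count H j = card {h\<in>set H. ne h = j}"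
proof -
  have "bij_betw (\<lambda>l. H !\<^sub>1 l) {l \<in> {1..length H}. ne (H !\<^sub>1 l) = j} {h\<in>set H. ne h = j}"
  proof (rule bij_betwI')
    fix l l' assume "l \<in> {l \<in> {1..length H}. ne (H !\<^sub>1 l) = j}" "l' \<in> {l \<in> {1..length H}. ne (H !\<^sub>1 l) = j}"
    then have "l - 1 < length H" "l' - 1 < length H" "1 \<le> l" "1 \<le> l'" by auto
    then show "(H !\<^sub>1 l = H !\<^sub>1 l') = (l = l')"
      unfolding nth1_def using nth_eq_iff_index_eq[OF assms, of "l - 1" "l' - 1"] by linarith
  next
    fix h assume h: "h \<in> {h\<in>set H. ne h = j}"
    then obtain l where "l < length H" "H ! l = h" by (auto simp: in_set_conv_nth)
    then show "\<exists>l\<in>{l \<in> {1..length H}. ne (H !\<^sub>1 l) = j}. h = H !\<^sub>1 l"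
      using h by (intro bexI[of _ "Suc l"]) (auto simp: nth1_def)
  qed (auto simp: nth1_in_set)
  then show ?thesis unfolding ne_count_def by (rule bij_betw_same_card)
qed

lemma pred_not_descent: "is_hook \<pi> (j - 1, j) \<Longrightarrow> j - 1 \<notin> descents \<pi>"
  by (auto simp: is_hook_def descents_def)

text \<open>At each northeast endpoint \<open>j\<close>, condition (c) provides a hook from a
  descent and the hook from \<open>j - 1\<close>. They differ because the values rise from
  \<open>j - 1\<close> to \<open>j\<close>, and \<open>ne_count H j = 2\<close> leaves room for no
  third hook.\<close>

lemma valid_hook_configurations_02D:
  assumes "H \<in> valid_hook_configurations_02 \<pi>"
  shows "descent_hooks H \<in> configurations val pos"
    and "set H = all_hooks (descent_hooks H)"
    and "sorted_wrt (<) (map fst H)" and "\<forall>h\<in>set H. is_hook \<pi> h"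
proof -
  note def = assms[unfolded valid_hook_configurations_02_def valid_hook_configurations_def mem_Collect_eq]
  have hook: "\<And>h. h \<in> set H \<Longrightarrow> is_hook \<pi> h" and sorted: "sorted_wrt (<) (map sw H)"
    and desc: "\<And>i. i \<in> descents \<pi> \<Longrightarrow> \<exists>h\<in>set H. sw h = i"
    and c: "\<And>h. h \<in> set H \<Longrightarrow> \<exists>h'\<in>set H. \<exists>h''\<in>set H.
       sw h' \<in> descents \<pi> \<and> sw h'' = ne h - 1 \<and> ne h' = ne h \<and> ne h'' = ne h"
    and nest: "\<And>h h'. h \<in> set H \<Longrightarrow> h' \<in> set H \<Longrightarrow> \<pi> !\<^sub>1 ne h < \<pi> !\<^sub>1 ne h' \<Longrightarrow>
       \<exists>x y. x \<noteq> y \<and> {x, y} \<subseteq> hook_interval h \<inter> hook_interval h' \<Longrightarrow> hook_interval h \<subseteq> hook_interval h'"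
    and two: "\<And>j. j \<in> pos \<Longrightarrow> ne_count H j \<in> {0, 2}"
    using def by blast+
  show "sorted_wrt (<) (map fst H)" "\<forall>h\<in>set H. is_hook \<pi> h" using sorted hook by auto
  have dH: "distinct H" and injf: "inj_on fst (set H)"
    using sorted by (auto simp: strict_sorted_iff distinct_map)
  have pair: "\<exists>i. i \<in> descents \<pi> \<and> {h\<in>set H. ne h = j} = {(i, j), (j - 1, j)} \<and> j - 1 \<notin> descents \<pi>"
    if ij: "(i0, j) \<in> set H" for i0 j
  proof -
    obtain h' h'' where h: "h' \<in> set H" "h'' \<in> set H" "sw h' \<in> descents \<pi>" "sw h'' = j - 1"
      "ne h' = j" "ne h'' = j"
      using c[OF ij] by auto
    then have h'': "h'' = (j - 1, j)" by (metis prod.collapse)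
    have nd: "j - 1 \<notin> descents \<pi>" using hook[OF h(2)] h'' pred_not_descent by simp
    then have "h' \<noteq> h''" using h by auto
    have "j \<in> pos" using hook[OF ij] by (auto simp: is_hook_def)
    then have "card {h\<in>set H. ne h = j} = 0 \<or> card {h\<in>set H. ne h = j} = 2"
      using two[of j] unfolding ne_count_eq[OF dH] by blast
    moreover have sub: "{h', h''} \<subseteq> {h\<in>set H. ne h = j}" using h by auto
    moreover have "2 \<le> card {h\<in>set H. ne h = j}"
      using card_mono[OF _ sub] \<open>h' \<noteq> h''\<close> by simp
    ultimately have "card {h\<in>set H. ne h = j} = 2" by linarith
    then have "card {h', h''} = card {h\<in>set H. ne h = j}" using \<open>h' \<noteq> h''\<close> by simp
    then have "{h', h''} = {h\<in>set H. ne h = j}" using sub by (intro card_subset_eq) auto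
    then show ?thesis using h h'' nd by (metis prod.collapse)
  qed
  show conf: "descent_hooks H \<in> configurations val pos"
  proof (rule configurationI)
    fix i j assume "(i, j) \<in> descent_hooks H"
    then show "i \<in> descents_on val pos \<and> j \<in> pos \<and> i < j \<and> val i < val j"
      using hook[of "(i, j)"] by (auto simp: descent_hooks_def descents_eq is_hook_def simp del: One_nat_def)
  next
    fix i assume "i \<in> descents_on val pos"
    then show "\<exists>j. (i, j) \<in> descent_hooks H"
      using desc[of i] by (auto simp: descent_hooks_def descents_eq simp del: One_nat_def)
  next
    fix i j j' assume "(i, j) \<in> descent_hooks H" "(i, j') \<in> descent_hooks H"
    then show "j = j'" using inj_onD[OF injf, of "(i, j)" "(i, j')"] by (simp add: descent_hooks_def)
  next
    fix i i' j assume *: "(i, j) \<in> descent_hooks H" "(i', j) \<in> descent_hooks H"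
    then obtain i0 where i0: "{h\<in>set H. ne h = j} = {(i0, j), (j - 1, j)}" "j - 1 \<notin> descents \<pi>"
      using pair[of i j] by (auto simp: descent_hooks_def)
    have "(i, j) \<in> {h\<in>set H. ne h = j}" "(i', j) \<in> {h\<in>set H. ne h = j}"
      using * by (auto simp: descent_hooks_def)
    then show "i = i'" using * i0 unfolding i0 by (auto simp: descent_hooks_def)
  next
    fix i j i' j' assume *: "(i, j) \<in> descent_hooks H" "(i', j') \<in> descent_hooks H"
      "val j < val j'" "i < j'" "i' < j"
    then have h: "(i, j) \<in> set H" "(i', j') \<in> set H" by (auto simp: descent_hooks_def)
    then have "i < j" "i' < j'" using hook by (auto simp: is_hook_def)
    then show "i' \<le> i \<and> j \<le> j'"
      using nest[OF h] * hook_interval_overlap[of i j i' j'] hook_interval_subset[of i j i' j'] by simp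
  qed
  show "set H = all_hooks (descent_hooks H)"
  proof (intro set_eqI iffI)
    fix h assume "h \<in> set H"
    then obtain i j where h: "h = (i, j)" "(i, j) \<in> set H" by (metis prod.collapse)
    obtain i0 where i0: "i0 \<in> descents \<pi>" "{h\<in>set H. ne h = j} = {(i0, j), (j - 1, j)}"
      using pair[OF h(2)] by blast
    then have "(i0, j) \<in> descent_hooks H" by (auto simp: descent_hooks_def)
    then have "(i0, j) \<in> all_hooks (descent_hooks H)" "(j - 1, j) \<in> all_hooks (descent_hooks H)"
      by (auto dest: all_hooksI)
    moreover have "(i, j) \<in> {h\<in>set H. ne h = j}" using h(2) by simp
    then have "(i, j) = (i0, j) \<or> (i, j) = (j - 1, j)" unfolding i0 by simp
    ultimately show "h \<in> all_hooks (descent_hooks H)" unfolding h(1) by metis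
  next
    fix h assume "h \<in> all_hooks (descent_hooks H)"
    then consider "h \<in> descent_hooks H" | i j where "(i, j) \<in> descent_hooks H" "h = (j - 1, j)"
      by (auto simp: all_hooks_def)
    then show "h \<in> set H"
    proof cases
      case (2 i j)
      then have "(i, j) \<in> set H" by (simp add: descent_hooks_def)
      then show ?thesis using pair[of i j] 2 by auto
    qed (simp add: descent_hooks_def)
  qed
qed

text \<open>That \<open>(j - 1, j)\<close> is a hook at all is due to \<open>below_hook\<close>. It
  does not start at a descent, so filtering by descents undoes \<open>all_hooks\<close>.\<close>

lemma all_hooks_properties:
  assumes C: "C \<in> configurations val pos"
  shows "finite (all_hooks C)" "inj_on fst (all_hooks C)" "\<forall>h\<in>all_hooks C. is_hook \<pi> h"
    and "{h\<in>all_hooks C. fst h \<in> descents \<pi>} = C"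
    and "(i, j) \<in> C \<Longrightarrow> {h\<in>all_hooks C. ne h = j} = {(i, j), (j - 1, j)} \<and> i \<noteq> j - 1"
proof -
  note D = configurationD[OF C]
  have "C \<subseteq> pos \<times> pos" using D(2,3) by auto
  then have "finite C" by (rule finite_subset) simp
  then show "finite (all_hooks C)" by (simp add: all_hooks_def)
  have hookC: "is_hook \<pi> (i, j)" if "(i, j) \<in> C" for i j
    using D(2,3,4,5)[OF that] by (auto simp: is_hook_def)
  \<comment> \<open>A descent is followed by a smaller value, so its hook cannot end at the next
    position.\<close>
  have ne_pred: "i < j - 1" if "(i, j) \<in> C" for i j
  proof -
    have "val (i + 1) < val i" using D(1)[OF that] by (simp add: descents_eq descents_def del: One_nat_def)
    then have "j \<noteq> i + 1" using D(5)[OF that] by auto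
    then show ?thesis using D(4)[OF that] by simp
  qed
  have hookP: "is_hook \<pi> (j - 1, j)" if "(i, j) \<in> C" for i j
  proof -
    have "j - 1 \<in> pos" "i < j - 1" "j - 1 < j" using ne_pred[OF that] D(3)[OF that] by auto
    then have "val (j - 1) < val j" using below_hook[OF C finite_atLeastAtMost inj_val that] by blast
    then show ?thesis using D(3)[OF that] \<open>j - 1 \<in> pos\<close> by (auto simp: is_hook_def)
  qed
  show hook: "\<forall>h\<in>all_hooks C. is_hook \<pi> h"
    using hookC hookP by (auto simp: all_hooks_def simp del: One_nat_def)
  have nd: "j - 1 \<notin> descents \<pi>" if "(i, j) \<in> C" for i j
    using pred_not_descent hookP[OF that] by blast
  have desc: "i \<in> descents \<pi>" if "(i, j) \<in> C" for i j using D(1)[OF that] by (simp add: descents_eq del: One_nat_def)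
  have cases: thesis if "h \<in> all_hooks C" "\<And>i j. (i, j) \<in> C \<Longrightarrow> h = (i, j) \<Longrightarrow> thesis"
    "\<And>i j. (i, j) \<in> C \<Longrightarrow> h = (j - 1, j) \<Longrightarrow> thesis" for h thesis
    using that by (cases h) (auto simp: all_hooks_def)
  show "{h\<in>all_hooks C. fst h \<in> descents \<pi>} = C"
  proof (intro set_eqI iffI)
    fix h assume "h \<in> {h\<in>all_hooks C. fst h \<in> descents \<pi>}"
    then have h: "h \<in> all_hooks C" "fst h \<in> descents \<pi>" by auto
    from h(1) show "h \<in> C" by (rule cases) (use h(2) nd in auto)
  next
    fix h assume "h \<in> C"
    then show "h \<in> {h\<in>all_hooks C. fst h \<in> descents \<pi>}"
      using desc[of "fst h" "snd h"] by (auto simp: all_hooks_def)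
  qed
  show "inj_on fst (all_hooks C)"
  proof (rule inj_onI)
    fix h h' assume h: "h \<in> all_hooks C" "h' \<in> all_hooks C" "fst h = fst h'"
    from h(1) show "h = h'"
    proof (rule cases)
      fix i j assume 1: "(i, j) \<in> C" "h = (i, j)"
      from h(2) show ?thesis
      proof (rule cases)
        fix i' j' assume "(i', j') \<in> C" "h' = (i', j')"
        then show ?thesis using 1 h(3) D(6)[of i j j'] by auto
      next
        fix i' j' assume "(i', j') \<in> C" "h' = (j' - 1, j')"
        then show ?thesis using 1 h(3) nd[of i' j'] desc[of i j] by auto
      qed
    next
      fix i j assume 1: "(i, j) \<in> C" "h = (j - 1, j)"
      from h(2) show ?thesis
      proof (rule cases)
        fix i' j' assume "(i', j') \<in> C" "h' = (i', j')"
        then show ?thesis using 1 h(3) nd[of i j] desc[of i' j'] by auto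
      next
        fix i' j' assume 2: "(i', j') \<in> C" "h' = (j' - 1, j')"
        then have "j - 1 = j' - 1" using 1 h(3) by simp
        moreover have "0 < j" "0 < j'" using D(4) 1 2 by fastforce+
        ultimately show ?thesis using 1 2 by simp
      qed
    qed
  qed
  show "{h\<in>all_hooks C. ne h = j} = {(i, j), (j - 1, j)} \<and> i \<noteq> j - 1" if ij: "(i, j) \<in> C"
  proof
    show "i \<noteq> j - 1" using ne_pred[OF ij] by simp
    show "{h\<in>all_hooks C. ne h = j} = {(i, j), (j - 1, j)}"
    proof (intro set_eqI iffI)
      fix h assume "h \<in> {h\<in>all_hooks C. ne h = j}"
      then have h: "h \<in> all_hooks C" "ne h = j" by auto
      from h(1) show "h \<in> {(i, j), (j - 1, j)}"
        by (rule cases) (use h(2) D(7)[OF ij] in auto)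
    next
      fix h assume "h \<in> {(i, j), (j - 1, j)}"
      then show "h \<in> {h\<in>all_hooks C. ne h = j}" using ij by (force simp: all_hooks_def)
    qed
  qed
qed

lemma hook_list_valid:
  assumes C: "C \<in> configurations val pos"
  shows "hook_list (all_hooks C) \<in> valid_hook_configurations_02 \<pi>"
    and "descent_hooks (hook_list (all_hooks C)) = C"
proof -
  note D = configurationD[OF C] and P = all_hooks_properties[OF C]
  let ?H = "hook_list (all_hooks C)"
  have set: "set ?H = all_hooks C" and sorted: "sorted_wrt (<) (map fst ?H)"
    using set_hook_list sorted_hook_list P(1,2) by blast+
  show "descent_hooks ?H = C" unfolding descent_hooks_def set by (rule P(4))
  have dH: "distinct ?H" using sorted by (auto simp: strict_sorted_iff distinct_map)
  have snd_C: "\<exists>i. (i, ne h) \<in> C" if "h \<in> all_hooks C" for h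
    using that by (auto simp: all_hooks_def) (metis prod.collapse)
  have desc: "\<forall>i\<in>descents \<pi>. \<exists>h\<in>all_hooks C. sw h = i"
    using D(9) by (force simp: descents_eq all_hooks_def simp del: One_nat_def)
  have c: "\<exists>h'\<in>all_hooks C. \<exists>h''\<in>all_hooks C.
       sw h' \<in> descents \<pi> \<and> sw h'' = ne h - 1 \<and> ne h' = ne h \<and> ne h'' = ne h"
    if h: "h \<in> all_hooks C" for h
  proof -
    obtain i where i: "(i, ne h) \<in> C" using snd_C[OF h] by blast
    then have "(i, ne h) \<in> all_hooks C" "(ne h - 1, ne h) \<in> all_hooks C"
      by (auto dest: all_hooksI)
    moreover have "i \<in> descents \<pi>" using D(1)[OF i] by (simp add: descents_eq del: One_nat_def)
    ultimately show ?thesis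
      by (intro bexI[of _ "(i, ne h)"] bexI[of _ "(ne h - 1, ne h)"]) auto
  qed
  \<comment> \<open>Each hook is compared with the hook from a descent that has the same northeast
    endpoint and starts no later; nesting of those gives \<open>j < j'\<close>. Since
    \<open>h'\<close> overlaps \<open>h\<close>, it cannot be the short hook from
    \<open>j' - 1\<close>.\<close>
  have nest: "hook_interval h \<subseteq> hook_interval h'"
    if h: "h \<in> all_hooks C" "h' \<in> all_hooks C" and val: "val (ne h) < val (ne h')"
      and ov: "\<exists>x y. x \<noteq> y \<and> {x, y} \<subseteq> hook_interval h \<inter> hook_interval h'" for h h'
  proof -
    obtain i j i' j' where e: "h = (i, j)" "h' = (i', j')" by (cases h; cases h')
    have lt: "i < j" "i' < j'" using P(3) h e by (auto simp: is_hook_def)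
    then have ov: "i < j'" "i' < j" using ov hook_interval_overlap[OF lt] e by auto
    obtain i0 where i0: "(i0, j) \<in> C" using snd_C[OF h(1)] e by auto
    obtain i1 where i1: "(i1, j') \<in> C" using snd_C[OF h(2)] e by auto
    have "(i, j) \<in> {h\<in>all_hooks C. ne h = j}" using h(1) e(1) by simp
    then have h0: "i = i0 \<or> i = j - 1" using P(5)[OF i0] by simp
    have "(i', j') \<in> {h\<in>all_hooks C. ne h = j'}" using h(2) e(2) by simp
    then have h1: "i' = i1 \<or> i' = j' - 1" using P(5)[OF i1] by simp
    have le: "i1 \<le> i'" using h1 D(4)[OF i1] by auto
    have le0: "i0 \<le> i" using h0 D(4)[OF i0] by auto
    have "i1 \<le> i0 \<and> j \<le> j'"
      using D(8)[OF i0 i1] val e ov le le0 by simp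
    moreover have "j \<noteq> j'" using val e by auto
    ultimately have "i' \<noteq> j' - 1 \<or> i' = i1" using ov by auto
    then have "i' = i1" using h1 by blast
    then have "i' \<le> i \<and> j \<le> j'" using \<open>i1 \<le> i0 \<and> j \<le> j'\<close> le0 by simp
    then show ?thesis using hook_interval_subset[OF lt(1)] e by simp
  qed
  have two: "ne_count ?H j \<in> {0, 2}" for j
  proof (cases "\<exists>i. (i, j) \<in> C")
    case True
    then obtain i where "(i, j) \<in> C" by blast
    then show ?thesis using P(5)[of i j] by (simp add: ne_count_eq[OF dH] set)
  next
    case False
    then have "{h\<in>all_hooks C. ne h = j} = {}" using snd_C by blast
    then show ?thesis unfolding ne_count_eq[OF dH] set by (simp only: card.empty) simp
  qed
  show "?H \<in> valid_hook_configurations_02 \<pi>"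
    unfolding valid_hook_configurations_02_def valid_hook_configurations_def mem_Collect_eq set
    by (intro conjI ballI impI sorted c two P(3)[rule_format] desc[rule_format]; (elim conjE)?)
      (assumption | rule nest)+
qed

end

section \<open>Colors of a valid hook configuration\<close>

locale hook_configuration = distinct_word +
  fixes H :: "hook list"
  assumes H: "H \<in> valid_hook_configurations_02 \<pi>"
begin

abbreviation "C \<equiv> descent_hooks H"

lemmas C_conf = valid_hook_configurations_02D(1)[OF H]
lemmas C_D = configurationD[OF C_conf]
lemmas set_H = valid_hook_configurations_02D(2)[OF H]
lemmas sorted_H = valid_hook_configurations_02D(3)[OF H]

lemma C_iff: "h \<in> C \<longleftrightarrow> h \<in> set H \<and> fst h \<in> descents \<pi>"
  by (simp add: descent_hooks_def)

lemma nth1_H_in: "l \<in> {1..length H} \<Longrightarrow> H !\<^sub>1 l \<in> set H"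
  by (simp add: nth1_in_set)

lemma ex_index: "h \<in> set H \<Longrightarrow> \<exists>l\<in>{1..length H}. H !\<^sub>1 l = h"
proof -
  assume "h \<in> set H"
  then obtain l where "l < length H" "H ! l = h" by (auto simp: in_set_conv_nth)
  then show ?thesis by (intro bexI[of _ "Suc l"]) (auto simp: nth1_def)
qed

lemma sw_less_iff:
  assumes "l \<in> {1..length H}" "l' \<in> {1..length H}"
  shows "sw (H !\<^sub>1 l) < sw (H !\<^sub>1 l') \<longleftrightarrow> l < l'"
proof -
  have *: "sw (H !\<^sub>1 a) < sw (H !\<^sub>1 b)" if "a < b" "a \<in> {1..length H}" "b \<in> {1..length H}" for a b
  proof -
    have "a - 1 < b - 1" "b - 1 < length (map fst H)" using that by auto
    from sorted_wrt_nth_less[OF sorted_H this] show ?thesis using that by (simp add: nth1_def)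
  qed
  show ?thesis using *[of l l'] *[of l' l] assms by (cases l l' rule: linorder_cases) auto
qed

lemma sw_eq_iff:
  assumes "l \<in> {1..length H}" "l' \<in> {1..length H}"
  shows "sw (H !\<^sub>1 l) = sw (H !\<^sub>1 l') \<longleftrightarrow> l = l'"
  using sw_less_iff[OF assms] sw_less_iff[OF assms(2,1)] by (cases l l' rule: linorder_cases) auto

lemma hook_cases:
  assumes "h \<in> set H"
  obtains "h \<in> C" | i where "(i, ne h) \<in> C" "h = (ne h - 1, ne h)" "fst h \<notin> descents \<pi>"
proof (cases "h \<in> C")
  case False
  moreover have "h \<in> all_hooks C" using assms set_H by blast
  ultimately have "h \<in> (\<lambda>j. (j - 1, j)) ` snd ` C" unfolding all_hooks_def by blast
  then obtain i j where "(i, j) \<in> C" "h = (j - 1, j)" by auto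
  moreover have "fst h \<notin> descents \<pi>" using False assms C_iff by blast
  ultimately show thesis using that(2)[of i] by simp
qed (use that in blast)

lemma NE_eq: "NE H = snd ` C"
proof -
  have "snd ` all_hooks C = snd ` C" by (force simp: all_hooks_def)
  then show ?thesis using set_H by (simp add: NE_def)
qed

lemma NE_D:
  assumes "x \<in> NE H"
  shows "x - 1 \<notin> descents \<pi>" "(x - 1, x) \<in> set H" "\<And>h. h \<in> set H \<Longrightarrow> ne h = x \<Longrightarrow> fst h \<le> x - 1"
proof -
  obtain i where i: "(i, x) \<in> C" using assms unfolding NE_eq by auto
  then show P: "(x - 1, x) \<in> set H" using all_hooksI(2) set_H by blast
  then have "is_hook \<pi> (x - 1, x)" using valid_hook_configurations_02D(4)[OF H] by blast
  then show "x - 1 \<notin> descents \<pi>" by (rule pred_not_descent)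
  fix h assume "h \<in> set H" "ne h = x"
  then have "fst h < x" using valid_hook_configurations_02D(4)[OF H] by (auto simp: is_hook_def)
  then show "fst h \<le> x - 1" by simp
qed

text \<open>Indices follow the southwest endpoints, and among the hooks ending at \<open>x\<close>
  the one from \<open>x - 1\<close> starts furthest right.\<close>

lemma color_NE:
  assumes x: "x \<in> NE H"
  shows "color \<pi> H x \<in> {1..length H}" "H !\<^sub>1 color \<pi> H x = (x - 1, x)"
proof -
  obtain r where r: "r \<in> {1..length H}" "H !\<^sub>1 r = (x - 1, x)" using ex_index NE_D(2)[OF x] by blast
  let ?R = "{r \<in> {1..length H}. ne (H !\<^sub>1 r) = x}"
  have "Max ?R = r"
  proof (rule Max_eqI)
    fix y assume y: "y \<in> ?R"
    then have "fst (H !\<^sub>1 y) \<le> x - 1" using NE_D(3)[OF x nth1_H_in] by blast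
    then have "\<not> sw (H !\<^sub>1 r) < sw (H !\<^sub>1 y)" using r by simp
    then show "y \<le> r" using sw_less_iff[OF r(1), of y] y by simp
  qed (use r in auto)
  then have "color \<pi> H x = r" using x by (simp add: color_def)
  then show "color \<pi> H x \<in> {1..length H}" "H !\<^sub>1 color \<pi> H x = (x - 1, x)" using r by simp_all
qed

text \<open>Translates a color, given as an index into \<open>H\<close>, into the labels that
  \<open>innermost\<close> uses.\<close>

definition hook_start :: "nat \<Rightarrow> nat"
  where "hook_start l = (if l = 0 then 0 else fst (H !\<^sub>1 l))"

text \<open>A hook from \<open>j - 1\<close> to \<open>j\<close> has only the point over
  \<open>j\<close> below its top part, so it colors no other point. For hooks from descents the
  comparison of heights in \<open>hit\<close> follows from \<open>below_hook\<close>, and the shift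
  by 1/2 means starting left of \<open>x\<close>.\<close>

lemma hit_eq:
  assumes x: "x \<in> pos" "x \<notin> NE H"
  shows "hit \<pi> H x = {l \<in> {1..length H}. H !\<^sub>1 l \<in> C \<and> sw (H !\<^sub>1 l) < x \<and> x < ne (H !\<^sub>1 l)}"
proof (intro set_eqI iffI)
  fix l assume "l \<in> hit \<pi> H x"
  then have l: "l \<in> {1..length H}" "real (sw (H !\<^sub>1 l)) + 1/2 \<le> real x" "x \<le> ne (H !\<^sub>1 l)"
    by (auto simp: hit_def)
  have h: "H !\<^sub>1 l \<in> set H" using l(1) nth1_H_in by blast
  have "real (sw (H !\<^sub>1 l)) < real x" using l(2) by linarith
  then have "sw (H !\<^sub>1 l) < x" by simp
  moreover have "x \<noteq> ne (H !\<^sub>1 l)" using x(2) h by (auto simp: NE_def)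
  then have "x < ne (H !\<^sub>1 l)" using l(3) by simp
  moreover from h have "H !\<^sub>1 l \<in> C"
  proof (cases rule: hook_cases)
    case (2 i)
    then have "sw (H !\<^sub>1 l) = ne (H !\<^sub>1 l) - 1" by (metis fst_conv)
    then show ?thesis using calculation by simp
  qed
  ultimately show "l \<in> {l \<in> {1..length H}. H !\<^sub>1 l \<in> C \<and> sw (H !\<^sub>1 l) < x \<and> x < ne (H !\<^sub>1 l)}"
    using l(1) by simp
next
  fix l assume "l \<in> {l \<in> {1..length H}. H !\<^sub>1 l \<in> C \<and> sw (H !\<^sub>1 l) < x \<and> x < ne (H !\<^sub>1 l)}"
  then have l: "l \<in> {1..length H}" "(sw (H !\<^sub>1 l), ne (H !\<^sub>1 l)) \<in> C" "sw (H !\<^sub>1 l) < x" "x < ne (H !\<^sub>1 l)"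
    by auto
  then have "val x < val (ne (H !\<^sub>1 l))"
    using below_hook[OF C_conf finite_atLeastAtMost inj_val l(2)] x by blast
  moreover have "real (sw (H !\<^sub>1 l)) + 1 \<le> real x" using l(3) by linarith
  ultimately show "l \<in> hit \<pi> H x" using l by (simp add: hit_def)
qed

text \<open>Two hooks from descents over the same point are nested, and the one that starts further
  right is the lower one. So the first hit is a single hook, and it starts at
  \<open>innermost C x\<close>.\<close>

lemma color_not_NE:
  assumes x: "x \<in> pos" "x \<notin> NE H"
  shows "color \<pi> H x = 0 \<or> color \<pi> H x \<in> {1..length H} \<and> H !\<^sub>1 color \<pi> H x \<in> C"
    and "hook_start (color \<pi> H x) = innermost C x"
proof -
  let ?I = "{i. \<exists>j. (i, j) \<in> C \<and> i < x \<and> x < j}"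
  have fin: "finite ?I" by (rule finite_subset[of _ "{..<x}"]) auto
  have "(color \<pi> H x = 0 \<or> color \<pi> H x \<in> {1..length H} \<and> H !\<^sub>1 color \<pi> H x \<in> C) \<and>
    hook_start (color \<pi> H x) = innermost C x"
  proof (cases "hit \<pi> H x = {}")
    case True
    have "?I = {}"
    proof (rule ccontr)
      assume "?I \<noteq> {}"
      then obtain i j where ij: "(i, j) \<in> C" "i < x" "x < j" by blast
      then obtain l where l: "l \<in> {1..length H}" "H !\<^sub>1 l = (i, j)" using ex_index C_iff by blast
      then have "l \<in> hit \<pi> H x" unfolding hit_eq[OF x] using ij by simp
      then show False using True by simp
    qed
    then have "innermost C x = 0" unfolding innermost_def by (simp only:) simp
    then show ?thesis using True x(2) by (simp add: color_def hook_start_def)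
  next
    case False
    define i where "i = Max ?I"
    obtain l0 where "l0 \<in> hit \<pi> H x" using False by blast
    then have "(sw (H !\<^sub>1 l0), ne (H !\<^sub>1 l0)) \<in> C" "sw (H !\<^sub>1 l0) < x" "x < ne (H !\<^sub>1 l0)"
      unfolding hit_eq[OF x] by auto
    then have "?I \<noteq> {}" by blast
    then have "i \<in> ?I" unfolding i_def using fin by (intro Max_in)
    then obtain j where ij: "(i, j) \<in> C" "i < x" "x < j" by blast
    then obtain l where l: "l \<in> {1..length H}" "H !\<^sub>1 l = (i, j)" using ex_index C_iff by blast
    have l_hit: "l \<in> hit \<pi> H x" unfolding hit_eq[OF x] using ij l by simp
    have lower: "l' = l \<or> val j < val (ne (H !\<^sub>1 l'))" if l': "l' \<in> hit \<pi> H x" for l'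
    proof -
      obtain i' j' where h': "H !\<^sub>1 l' = (i', j')" by (metis prod.collapse)
      have l'': "l' \<in> {1..length H}" "(i', j') \<in> C" "i' < x" "x < j'"
        using l' h' unfolding hit_eq[OF x] by auto
      then have "i' \<le> i" unfolding i_def using fin by (intro Max_ge) auto
      show ?thesis
      proof (rule disjCI)
        assume *: "\<not> val j < val (ne (H !\<^sub>1 l'))"
        have "i' = i"
        proof (rule ccontr)
          assume "i' \<noteq> i"
          then have "j' \<noteq> j" using C_D(7)[OF ij(1)] l''(2) by blast
          then have "val j' \<noteq> val j"
            using inj_onD[OF inj_val, of j' j] C_D(3)[OF ij(1)] C_D(3)[OF l''(2)] by blast
          then have "val j' < val j" using * h' by simp
          then have "i \<le> i'" using C_D(8)[OF l''(2) ij(1)] ij l'' by simp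
          then show False using \<open>i' \<le> i\<close> \<open>i' \<noteq> i\<close> by simp
        qed
        then show "l' = l" using sw_eq_iff[OF l''(1) l(1)] l(2) h' by simp
      qed
    qed
    have "first_hit \<pi> H x = {l}"
    proof (intro set_eqI iffI)
      fix l' assume l': "l' \<in> first_hit \<pi> H x"
      then have "val (ne (H !\<^sub>1 l')) \<le> val (ne (H !\<^sub>1 l))" using l_hit by (auto simp: first_hit_def)
      then show "l' \<in> {l}" using lower[of l'] l' l(2) by (auto simp: first_hit_def)
    next
      fix l' assume "l' \<in> {l}"
      then show "l' \<in> first_hit \<pi> H x"
        using l_hit lower l(2) by (fastforce simp: first_hit_def)
    qed
    then have col: "color \<pi> H x = l"
      using x(2) False by (simp add: color_def arg_max_def is_arg_max_def cong: conj_cong)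
    have "innermost C x = i"
      unfolding innermost_def i_def using fin \<open>?I \<noteq> {}\<close> by simp
    then show ?thesis using col l ij by (simp add: hook_start_def)
  qed
  then show "color \<pi> H x = 0 \<or> color \<pi> H x \<in> {1..length H} \<and> H !\<^sub>1 color \<pi> H x \<in> C"
    "hook_start (color \<pi> H x) = innermost C x" by blast+
qed

text \<open>By \<open>color_NE\<close>, the colors of northeast endpoints are exactly those of the
  hooks from \<open>j - 1\<close> to \<open>j\<close>; the others start at descents.\<close>

lemma Theta_eq: "Theta \<pi> H = insert 0 {l \<in> {1..length H}. H !\<^sub>1 l \<in> C}"
proof (intro set_eqI iffI)
  fix l assume l: "l \<in> Theta \<pi> H"
  show "l \<in> insert 0 {l \<in> {1..length H}. H !\<^sub>1 l \<in> C}"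
  proof (cases "l = 0")
    case False
    then have l1: "l \<in> {1..length H}" using l by (auto simp: Theta_def)
    then have h: "H !\<^sub>1 l \<in> set H" by (rule nth1_H_in)
    then have "H !\<^sub>1 l \<in> C"
    proof (cases rule: hook_cases)
      case (2 i)
      define x where "x = ne (H !\<^sub>1 l)"
      have x: "x \<in> NE H" using h by (auto simp: NE_def x_def)
      have "H !\<^sub>1 l = (x - 1, x)" using 2 by (simp add: x_def)
      then have "color \<pi> H x = l" using color_NE[OF x] sw_eq_iff[of "color \<pi> H x" l] l1 by simp
      then show ?thesis using l x by (auto simp: Theta_def)
    qed
    then show ?thesis using l1 by simp
  qed simp
next
  fix l assume l: "l \<in> insert 0 {l \<in> {1..length H}. H !\<^sub>1 l \<in> C}"
  have "color \<pi> H x \<noteq> l" if x: "x \<in> NE H" for x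
  proof
    assume c: "color \<pi> H x = l"
    then have "l \<noteq> 0" using color_NE(1)[OF x] by auto
    then have "fst (H !\<^sub>1 l) \<in> descents \<pi>" using l C_iff by auto
    then show False using color_NE(2)[OF x] NE_D(1)[OF x] c by simp
  qed
  then show "l \<in> Theta \<pi> H" using l by (auto simp: Theta_def)
qed

lemma bij_hook_start: "bij_betw hook_start (Theta \<pi> H) (insert 0 (descents \<pi>))"
proof (rule bij_betw_imageI)
  have pos: "0 < fst (H !\<^sub>1 l)" if "H !\<^sub>1 l \<in> C" for l
    using that by (auto simp: C_iff descents_def)
  show "inj_on hook_start (Theta \<pi> H)"
  proof (rule inj_onI)
    fix l l' assume "l \<in> Theta \<pi> H" "l' \<in> Theta \<pi> H" "hook_start l = hook_start l'"
    then show "l = l'" unfolding Theta_eq hook_start_def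
      using pos[of l] pos[of l'] sw_eq_iff[of l l'] by (auto split: if_splits)
  qed
  show "hook_start ` Theta \<pi> H = insert 0 (descents \<pi>)"
  proof (intro set_eqI iffI)
    fix d assume "d \<in> hook_start ` Theta \<pi> H"
    then show "d \<in> insert 0 (descents \<pi>)" unfolding Theta_eq by (auto simp: hook_start_def C_iff)
  next
    fix d assume d: "d \<in> insert 0 (descents \<pi>)"
    show "d \<in> hook_start ` Theta \<pi> H"
    proof (cases "d = 0")
      case True
      then show ?thesis unfolding Theta_eq by (auto simp: hook_start_def image_iff)
    next
      case False
      then have "d \<in> descents_on val pos" using d unfolding descents_eq by simp
      then obtain j where j: "(d, j) \<in> C" using C_D(9) by blast
      then obtain l where l: "l \<in> {1..length H}" "H !\<^sub>1 l = (d, j)" using ex_index C_iff by blast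
      then have "l \<in> Theta \<pi> H" "hook_start l = d" unfolding Theta_eq using j by (auto simp: hook_start_def)
      then show ?thesis by blast
    qed
  qed
qed

lemma q_eq:
  assumes l: "l \<in> Theta \<pi> H"
  shows "q \<pi> H l = color_count pos C (hook_start l)"
proof -
  have "color \<pi> H x = l \<longleftrightarrow> innermost C x = hook_start l" if x: "x \<in> pos" "x \<notin> NE H" for x
  proof -
    have "color \<pi> H x \<in> Theta \<pi> H" unfolding Theta_eq using color_not_NE(1)[OF x] by blast
    then show ?thesis
      using inj_on_eq_iff[OF bij_betw_imp_inj_on[OF bij_hook_start] _ l] color_not_NE(2)[OF x] by metis
  qed
  moreover have "color \<pi> H x \<noteq> l" if "x \<in> NE H" for x using l that by (simp add: Theta_def)
  ultimately have "{x \<in> pos. color \<pi> H x = l} = {x \<in> pos - snd ` C. innermost C x = hook_start l}"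
    unfolding NE_eq[symmetric] by blast
  then show ?thesis by (simp add: q_def color_count_def)
qed

text \<open>\<open>q_hat\<close> runs through \<open>Theta\<close> in increasing order, but a
  product does not depend on the order, so \<open>hook_start\<close> may rename the colors to
  \<open>0\<close> and the descents.\<close>

lemma prod_q_hat:
  assumes "card (descents \<pi>) = k"
  shows "(\<Prod>t = 0..k. g (q_hat \<pi> H t)) =
    (\<Prod>c\<in>insert 0 (descents_on val pos). g (color_count pos C c))"
proof -
  let ?xs = "sorted_list_of_set (Theta \<pi> H)"
  have fin: "finite (Theta \<pi> H)" by (simp add: Theta_def)
  have "finite (descents \<pi>)" "0 \<notin> descents \<pi>" by (auto simp: descents_def)
  then have "card (Theta \<pi> H) = Suc k"
    using bij_betw_same_card[OF bij_hook_start] assms by simp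
  then have "bij_betw (\<lambda>t. ?xs ! t) {0..k} (Theta \<pi> H)"
    using fin by (intro bij_betw_nth) auto
  then have "(\<Prod>t = 0..k. g (q_hat \<pi> H t)) = (\<Prod>l\<in>Theta \<pi> H. g (q \<pi> H l))"
    unfolding q_hat_def by (rule prod.reindex_bij_betw)
  also have "\<dots> = (\<Prod>l\<in>Theta \<pi> H. g (color_count pos C (hook_start l)))"
    by (rule prod.cong) (simp_all add: q_eq)
  also have "\<dots> = (\<Prod>c\<in>insert 0 (descents \<pi>). g (color_count pos C c))"
    by (rule prod.reindex_bij_betw[OF bij_hook_start])
  finally show ?thesis unfolding descents_eq .
qed

end

context distinct_word
begin

lemma sum_valid_hook_configurations:
  assumes "card (descents \<pi>) = k"
  shows "(\<Sum>H\<in>valid_hook_configurations_02 \<pi>. \<Prod>t = 0..k. unary_binary_gf (q_hat \<pi> H t)) =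
    configuration_gf val pos"
  unfolding configuration_gf_def
proof (rule sum.reindex_bij_witness[of _ "\<lambda>C. hook_list (all_hooks C)" descent_hooks])
  fix H assume H: "H \<in> valid_hook_configurations_02 \<pi>"
  interpret hook_configuration \<pi> H by unfold_locales (rule H)
  show "hook_list (all_hooks (descent_hooks H)) = H"
    using hook_list_eq[OF sorted_H] set_H by simp
  show "descent_hooks H \<in> configurations val pos" by (rule C_conf)
  show "(\<Prod>c\<in>insert 0 (descents_on val pos). unary_binary_gf (color_count pos (descent_hooks H) c)) =
      (\<Prod>t = 0..k. unary_binary_gf (q_hat \<pi> H t))"
    by (rule prod_q_hat[OF assms, symmetric])
next
  fix C assume "C \<in> configurations val pos"
  then show "descent_hooks (hook_list (all_hooks C)) = C"
    "hook_list (all_hooks C) \<in> valid_hook_configurations_02 \<pi>"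
    using hook_list_valid by blast+
qed

end

section \<open>Comparison of coefficients for a permutation of [n]\<close>

theorem corollary5p1:
  fixes n p k :: nat and \<pi> :: "nat list"
  assumes "n \<ge> 1"
    and "\<pi> \<in> permutations_of_set {1..n}"
    and "card (descents \<pi>) = k"
  shows "real (card {\<sigma> \<in> permutations_of_set {1..n}. card (valleys \<sigma>) = p \<and> stack_sort \<sigma> = \<pi>}) =
    2 powi (int n - 2 * int p + 1) *
    (\<Sum>(H, j) \<in> valid_hook_configurations_02 \<pi> \<times> compositions k p.
       \<Prod>t = 0..k. real (((q_hat \<pi> H t - 1) choose (2 * (j ! t) - 2)) * catalan (j ! t - 1)))"
proof -
  have \<pi>: "distinct \<pi>" "set \<pi> = {1..n}" using permutations_of_setD[OF assms(2)] by blast+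
  then have len: "length \<pi> = n" using distinct_card[of \<pi>] by simp
  interpret distinct_word \<pi> by unfold_locales (rule \<pi>(1))
  have perm: "\<sigma> \<in> permutations_of_set {1..n}" if "stack_sort \<sigma> = \<pi>" for \<sigma>
    using that \<pi> set_stack_sort[of \<sigma>] mset_eq_imp_distinct_iff[OF mset_stack_sort[of \<sigma>]]
    by (simp add: permutations_of_set_def)
  have "{\<sigma> \<in> permutations_of_set {1..n}. card (valleys \<sigma>) = p \<and> stack_sort \<sigma> = \<pi>} =
      {\<sigma>. stack_sort \<sigma> = \<pi> \<and> card (valleys \<sigma>) = p}"
    using \<pi> perm by blast
  then have "real (card {\<sigma> \<in> permutations_of_set {1..n}. card (valleys \<sigma>) = p \<and> stack_sort \<sigma> = \<pi>}) =
      fps_nth (preimage_gf \<pi>) p"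
    by (simp add: preimage_gf_nth)
  also have "\<dots> = 2 ^ Suc n / 4 ^ p * fps_nth (tree_gf val pos) p"
    using preimage_gf_nth_tree_gf[of val pos p] unfolding word_val by (simp add: len)
  \<comment> \<open>The exponent is negative for \<open>2 * p > n + 1\<close>, hence
    \<open>powi\<close>.\<close>
  also have "2 ^ Suc n / 4 ^ p = (2 :: real) powi (int n - 2 * int p + 1)"
  proof -
    have *: "int n - 2 * int p + 1 = int (Suc n) - int (2 * p)" by simp
    have "(2 :: real) powi (int n - 2 * int p + 1) = 2 powi int (Suc n) / 2 powi int (2 * p)"
      unfolding * by (rule power_int_diff) simp
    also have "\<dots> = 2 ^ Suc n / 4 ^ p" by (simp only: power_int_of_nat power_mult) simp
    finally show ?thesis by simp
  qed
  \<comment> \<open>Here \<open>n \<ge> 1\<close> makes the set of positions nonempty.\<close>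
  also have "tree_gf val pos = configuration_gf val pos"
    using assms(1) len inj_val by (intro tree_gf_eq_configuration_gf) auto
  also have "\<dots> = (\<Sum>H\<in>valid_hook_configurations_02 \<pi>. \<Prod>t = 0..k. unary_binary_gf (q_hat \<pi> H t))"
    by (rule sum_valid_hook_configurations[OF assms(3), symmetric])
  also have "fps_nth \<dots> p = (\<Sum>H\<in>valid_hook_configurations_02 \<pi>. \<Sum>j\<in>compositions k p.
      \<Prod>t = 0..k. fps_nth (unary_binary_gf (q_hat \<pi> H t)) (j ! t))"
    by (simp add: fps_sum_nth sum_compositions unary_binary_gf_nth_0)
  also have "\<dots> = (\<Sum>(H, j) \<in> valid_hook_configurations_02 \<pi> \<times> compositions k p.
      \<Prod>t = 0..k. fps_nth (unary_binary_gf (q_hat \<pi> H t)) (j ! t))"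
    by (rule sum.cartesian_product)
  also have "\<dots> = (\<Sum>(H, j) \<in> valid_hook_configurations_02 \<pi> \<times> compositions k p.
       \<Prod>t = 0..k. real (((q_hat \<pi> H t - 1) choose (2 * (j ! t) - 2)) * catalan (j ! t - 1)))"
  proof (rule sum.cong[OF refl], clarify, rule prod.cong[OF refl])
    fix H j t assume "j \<in> compositions k p" "t \<in> {0..k}"
    \<comment> \<open>Positive parts avoid the separate case of exponent \<open>0\<close> in
      \<open>unary_binary_gf\<close>.\<close>
    then have "j ! t \<noteq> 0" by (auto simp: compositions_def)
    then show "fps_nth (unary_binary_gf (q_hat \<pi> H t)) (j ! t) =
        real (((q_hat \<pi> H t - 1) choose (2 * (j ! t) - 2)) * catalan (j ! t - 1))"
      by (simp add: unary_binary_gf_def)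
  qed
  finally show ?thesis .
qed

end
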